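(* Let $k\in\mathbb R$. The dual space $\left(A^1_{\omega^{-k}}(\mathbb C_+)\right)^*$ of $A^1_{\omega^{-k}}(\mathbb C_+)$ identifies with $\mathcal B_{\omega^k}(\mathbb C_+)$ modulo constants under the pairing $$\langle f,g\rangle_*=\int_{\mathbb C_+}f(z)\overline{g'(z)}\,(\Im m(z))\,dV(z),\qquad f\in A^1_{\omega^{-k}}(\mathbb C_+),\ g\in\mathcal B_{\omega^k}(\mathbb C_+).$$ That is, $g\mapsto\langle\cdot,g\rangle_*$ induces a bounded conjugate-linear bijection, with bounded inverse, from $\mathcal B_{\omega^k}(\mathbb C_+)/\mathbb C$ onto $\left(A^1_{\omega^{-k}}(\mathbb C_+)\right)^*$.
   Context: $\mathbb C_+=\{z\in\mathbb C:\Im m(z)>0\}$ with Lebesgue measure $dV$. With $\ln_+(t)=\max(\ln t,0)$, put $\omega(z)=1+\ln_+\left(\frac1{\Im m(z)}\right)+\ln_+(|z|)$. For $s\in\mathbb R$, $A^1_{\omega^s}(\mathbb C_+)$ is the Banach space of holomorphic functions on $\mathbb C_+$ with $\|f\|_{A^1_{\omega^s}}=\int_{\mathbb C_+}|f|\,\omega^s\,dV<\infty$. $\mathcal B_{\omega^k}(\mathbb C_+)$ is the space of holomorphic $g$ on $\mathbb C_+$ with $\sup_{z\in\mathbb C_+}\Im m(z)\,\omega^k(z)|g'(z)|<\infty$; this quantity is a norm on the quotient $\mathcal B_{\omega^k}(\mathbb C_+)/\mathbb C$ by constants. *)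

theory Defs
  imports "HOL-Complex_Analysis.Complex_Analysis"
begin

definition upper_half_plane :: "complex set" where
  "upper_half_plane = {z. Im z > 0}"

definition ln_plus :: "real \<Rightarrow> real" where
  "ln_plus t = max (ln t) 0"

definition omega :: "complex \<Rightarrow> real" where
  "omega z = 1 + ln_plus (1 / Im z) + ln_plus (cmod z)"

text \<open>
  A function on the upper half plane is represented by its extension by zero to the whole
  plane, so that two representatives are equal iff the functions are equal, and the
  vector space operations are the pointwise ones.
\<close>

definition holo_uhp :: "(complex \<Rightarrow> complex) set" where
  "holo_uhp = {f. f holomorphic_on upper_half_plane \<and> (\<forall>z. z \<notin> upper_half_plane \<longrightarrow> f z = 0)}"

definition A1 :: "real \<Rightarrow> (complex \<Rightarrow> complex) set" where
  "A1 s = {f \<in> holo_uhp.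
     set_integrable lborel upper_half_plane (\<lambda>z. cmod (f z) * omega z powr s)}"

definition A1_norm :: "real \<Rightarrow> (complex \<Rightarrow> complex) \<Rightarrow> real" where
  "A1_norm s f = (LINT z:upper_half_plane|lborel. cmod (f z) * omega z powr s)"

text \<open>
  The dual space: bounded complex-linear functionals on \<open>A1 s\<close>, again extended by zero
  outside \<open>A1 s\<close> so that equality is equality of functionals.
\<close>

definition A1_dual :: "real \<Rightarrow> ((complex \<Rightarrow> complex) \<Rightarrow> complex) set" where
  "A1_dual s = {L.
     (\<forall>f\<in>A1 s. \<forall>h\<in>A1 s. \<forall>a b. L (\<lambda>z. a * f z + b * h z) = a * L f + b * L h) \<and>
     (\<exists>C. \<forall>f\<in>A1 s. cmod (L f) \<le> C * A1_norm s f) \<and>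
     (\<forall>f. f \<notin> A1 s \<longrightarrow> L f = 0)}"

definition A1_dual_norm :: "real \<Rightarrow> ((complex \<Rightarrow> complex) \<Rightarrow> complex) \<Rightarrow> real" where
  "A1_dual_norm s L = (SUP f\<in>{f \<in> A1 s. A1_norm s f \<le> 1}. cmod (L f))"

definition bloch :: "real \<Rightarrow> (complex \<Rightarrow> complex) set" where
  "bloch k = {g \<in> holo_uhp.
     bdd_above ((\<lambda>z. Im z * omega z powr k * cmod (deriv g z)) ` upper_half_plane)}"

definition bloch_seminorm :: "real \<Rightarrow> (complex \<Rightarrow> complex) \<Rightarrow> real" where
  "bloch_seminorm k g = (SUP z\<in>upper_half_plane. Im z * omega z powr k * cmod (deriv g z))"

definition mod_const :: "real \<Rightarrow> ((complex \<Rightarrow> complex) \<times> (complex \<Rightarrow> complex)) set" where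
  "mod_const k = {(g, h). g \<in> bloch k \<and> h \<in> bloch k \<and>
     (\<exists>c. \<forall>z\<in>upper_half_plane. g z = h z + c)}"

definition bloch_class :: "real \<Rightarrow> (complex \<Rightarrow> complex) \<Rightarrow> (complex \<Rightarrow> complex) set" where
  "bloch_class k g = mod_const k `` {g}"

definition bloch_quot :: "real \<Rightarrow> (complex \<Rightarrow> complex) set set" where
  "bloch_quot k = bloch k // mod_const k"

text \<open>
  The seminorm is constant on each class (see \<open>bloch_quot_norm_class\<close> below), so the image
  of a class is a singleton.
\<close>

definition bloch_quot_norm :: "real \<Rightarrow> (complex \<Rightarrow> complex) set \<Rightarrow> real" where
  "bloch_quot_norm k X = the_elem (bloch_seminorm k ` X)"

definition pairing :: "(complex \<Rightarrow> complex) \<Rightarrow> (complex \<Rightarrow> complex) \<Rightarrow> complex" where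
  "pairing f g =
     (LINT z:upper_half_plane|lborel. f z * cnj (deriv g z) * complex_of_real (Im z))"

definition pairing_functional ::
    "real \<Rightarrow> (complex \<Rightarrow> complex) \<Rightarrow> (complex \<Rightarrow> complex) \<Rightarrow> complex" where
  "pairing_functional k g = (\<lambda>f. if f \<in> A1 (- k) then pairing f g else 0)"

definition induced_pairing ::
    "real \<Rightarrow> (complex \<Rightarrow> complex) set \<Rightarrow> (complex \<Rightarrow> complex) \<Rightarrow> complex" where
  "induced_pairing k X = the_elem (pairing_functional k ` X)"

lemma open_upper_half_plane: "open upper_half_plane"
  unfolding upper_half_plane_def by (rule open_halfspace_Im_gt)

lemma bloch_lincomb:
  assumes "g \<in> bloch k" "h \<in> bloch k"
  shows "(\<lambda>z. a * g z + b * h z) \<in> bloch k"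
proof -
  let ?w = "\<lambda>z. Im z * omega z powr k"
  have hol: "g holomorphic_on upper_half_plane" "h holomorphic_on upper_half_plane"
    using assms by (auto simp: bloch_def holo_uhp_def)
  obtain M N where
    M: "\<And>z. z \<in> upper_half_plane \<Longrightarrow> ?w z * cmod (deriv g z) \<le> M" and
    N: "\<And>z. z \<in> upper_half_plane \<Longrightarrow> ?w z * cmod (deriv h z) \<le> N"
    using assms by (auto simp: bloch_def bdd_above_def)
  have "?w z * cmod (deriv (\<lambda>z. a * g z + b * h z) z) \<le> cmod a * M + cmod b * N"
    if z: "z \<in> upper_half_plane" for z
  proof -
    have d: "g field_differentiable at z" "h field_differentiable at z"
      by (rule holomorphic_on_imp_differentiable_at[OF hol(1) open_upper_half_plane z],
          rule holomorphic_on_imp_differentiable_at[OF hol(2) open_upper_half_plane z])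
    have w: "?w z \<ge> 0"
      using z by (simp add: upper_half_plane_def)
    have "deriv (\<lambda>z. a * g z + b * h z) z = a * deriv g z + b * deriv h z"
      by (intro DERIV_imp_deriv DERIV_add DERIV_cmult d[THEN field_differentiable_derivI])
    then have "cmod (deriv (\<lambda>z. a * g z + b * h z) z)
        \<le> cmod a * cmod (deriv g z) + cmod b * cmod (deriv h z)"
      using norm_triangle_ineq[of "a * deriv g z" "b * deriv h z"] by (simp add: norm_mult)
    then have "?w z * cmod (deriv (\<lambda>z. a * g z + b * h z) z)
        \<le> ?w z * (cmod a * cmod (deriv g z) + cmod b * cmod (deriv h z))"
      using w by (rule mult_left_mono)
    also have "\<dots> = cmod a * (?w z * cmod (deriv g z)) + cmod b * (?w z * cmod (deriv h z))"
      by (simp add: algebra_simps)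
    also have "\<dots> \<le> cmod a * M + cmod b * N"
      by (intro add_mono mult_left_mono M N z) auto
    finally show ?thesis .
  qed
  then have "bdd_above ((\<lambda>z. ?w z * cmod (deriv (\<lambda>z. a * g z + b * h z) z)) ` upper_half_plane)"
    by (intro bdd_aboveI2) auto
  moreover have "(\<lambda>z. a * g z + b * h z) \<in> holo_uhp"
    using assms hol by (simp add: bloch_def holo_uhp_def holomorphic_on_add holomorphic_on_mult)
  ultimately show ?thesis
    by (simp add: bloch_def)
qed

lemma equiv_mod_const: "equiv (bloch k) (mod_const k)"
proof (rule equivI)
  show "mod_const k \<subseteq> bloch k \<times> bloch k"
    by (auto simp: mod_const_def)
  show "refl_on (bloch k) (mod_const k)"
    by (auto simp: refl_on_def mod_const_def intro: exI[of _ 0])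
  show "sym (mod_const k)"
  proof (rule symI)
    fix g h assume "(g, h) \<in> mod_const k"
    then obtain c where "g \<in> bloch k" "h \<in> bloch k" "\<forall>z\<in>upper_half_plane. g z = h z + c"
      by (auto simp: mod_const_def)
    then show "(h, g) \<in> mod_const k"
      by (auto simp: mod_const_def intro!: exI[of _ "- c"])
  qed
  show "trans (mod_const k)"
  proof (rule transI)
    fix f g h assume "(f, g) \<in> mod_const k" "(g, h) \<in> mod_const k"
    then obtain c d where mem: "f \<in> bloch k" "h \<in> bloch k"
      and c: "\<forall>z\<in>upper_half_plane. f z = g z + c"
      and d: "\<forall>z\<in>upper_half_plane. g z = h z + d"
      unfolding mod_const_def by blast
    have "\<forall>z\<in>upper_half_plane. f z = h z + (d + c)"
      using c d by (simp add: add.assoc)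
    then show "(f, h) \<in> mod_const k"
      using mem unfolding mod_const_def by blast
  qed
qed

lemma mod_const_deriv:
  assumes "(g, h) \<in> mod_const k" "z \<in> upper_half_plane"
  shows "deriv g z = deriv h z"
proof -
  obtain c where c: "\<forall>z\<in>upper_half_plane. g z = h z + c"
    and h: "h holomorphic_on upper_half_plane"
    using assms by (auto simp: mod_const_def bloch_def holo_uhp_def)
  have "eventually (\<lambda>z. g z = h z + c) (nhds z)"
    by (rule eventually_mono[OF eventually_nhds_in_open[OF open_upper_half_plane assms(2)]])
      (use c in simp)
  then have "deriv g z = deriv (\<lambda>z. h z + c) z"
    by (intro deriv_cong_ev) auto
  also have "\<dots> = deriv h z"
    using holomorphic_on_imp_differentiable_at[OF h open_upper_half_plane assms(2)]
    by (simp add: deriv_add)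
  finally show ?thesis .
qed

lemma bloch_quot_norm_class:
  assumes "g \<in> bloch k"
  shows "bloch_quot_norm k (bloch_class k g) = bloch_seminorm k g"
proof -
  have "bloch_seminorm k h = bloch_seminorm k g" if "h \<in> bloch_class k g" for h
    using that mod_const_deriv[of g h k]
    unfolding bloch_seminorm_def bloch_class_def by (intro SUP_cong) auto
  moreover have "g \<in> bloch_class k g"
    using equiv_class_self[OF equiv_mod_const assms] by (simp add: bloch_class_def)
  ultimately have "bloch_seminorm k ` bloch_class k g = {bloch_seminorm k g}"
    by (intro equalityI subsetI) (blast, metis image_eqI singletonD)
  then show ?thesis
    by (simp add: bloch_quot_norm_def)
qed

end

theory Submission
  imports Defs
begin

text \<open>
  The weight \<open>omega\<close> is logarithmic, hence varies by at most a power of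
  \<open>\<bar>z - cnj w\<bar>\<^sup>2 / (Im z * Im w)\<close>, with any prescribed exponent. Therefore the kernels
  \<open>K\<^sub>w(z) = (z - cnj w)\<^sup>-\<^sup>3\<close> satisfy \<open>\<parallel>K\<^sub>w\<parallel> \<le> C * omega w powr s / Im w\<close> in \<open>A1 s\<close> for every \<open>s\<close>.
  They reproduce both spaces: \<open>F(w) = (4\<i>/\<pi>) \<integral> F(z) * Im z * (cnj z - w)\<^sup>-\<^sup>3 dV(z)\<close> for \<open>F\<close> in \<open>A1\<close>
  and for \<open>F = g'\<close> with \<open>g\<close> in the Bloch space. For the latter, the formula reads
  \<open>cnj (g'(w)) = -(4\<i>/\<pi>) * L(K\<^sub>w)\<close> where \<open>L\<close> is the functional given by \<open>g\<close>, so \<open>L\<close> determines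
  \<open>g'\<close> and bounds its seminorm. Conversely, for a functional \<open>L\<close> this equation defines a
  holomorphic \<open>g'\<close> of the right size, and applying \<open>L\<close> under the integral in the reproducing
  formula for \<open>f\<close> shows that \<open>L\<close> is the pairing with \<open>g\<close>.
\<close>

subsection \<open>The weight and slicing of planar integrals\<close>

text \<open>The exponent 3 belongs to the Bergman kernel of the measure \<open>Im z dV\<close> of
  the pairing. For exponent 2 the integral of |z - cnj w|^-2 over the half plane diverges
  logarithmically. The extra power gives integrability and also pays for the variation of the
  weight: replacing \<open>omega z powr s\<close> by \<open>omega w powr s\<close> costs one factor
  |z - cnj w| / sqrt (Im z * Im w), and the integral that remains has an exact value. The constant
  has two sources: pi * i from Cauchy's formula for F'' on horizontal lines, and -1/4 from
  integrating y * F''(w + 2iy) over y > 0; 4i/pi is the inverse of their product. The obstacle is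
  moving L inside the reproducing integral, because L acts only on holomorphic functions and is not
  given by a density. The approximants must therefore be finite sums of kernels that converge in the
  weighted norm. For this reason the differences of kernels are bounded pointwise by multiples of
  |K_w| itself: such bounds pass to every weight at once. K_w depends antiholomorphically on w, so
  that cnj (L K_w) is the holomorphic object; this matches the conjugate in the pairing.\<close>

lemma uhp_iff: "z \<in> upper_half_plane \<longleftrightarrow> 0 < Im z"
  by (simp add: upper_half_plane_def)

lemma Im_add_le_cmod_diff_cnj: "Im z + Im w \<le> cmod (z - cnj w)"
  using abs_Im_le_cmod[of "z - cnj w"] by simp

lemma cmod_diff_cnj_commute: "cmod (z - cnj w) = cmod (w - cnj z)"
  by (metis complex_cnj_cnj complex_cnj_diff complex_mod_cnj norm_minus_commute)

lemma omega_ge_1: "1 \<le> omega z"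
  by (simp add: omega_def ln_plus_def)

text \<open>With D = |z - cnj w|, which is at least \<open>Im z\<close> and \<open>Im w\<close>, the
  two logarithmic terms of \<open>omega\<close> increase by at most ln (D / Im z) and ln 2 + ln (D /
  Im w). Since \<open>omega w\<close> is at least 1, the additive bound becomes a factor, a form
  that can be raised to a power.\<close>

lemma omega_le_mult_ln:
  assumes z: "0 < Im z" and w: "0 < Im w"
  shows "omega z \<le> omega w * (2 + 2 * ln ((cmod (z - cnj w))\<^sup>2 / (Im z * Im w)))"
proof -
  define D where "D = cmod (z - cnj w)"
  have D: "Im z \<le> D" "Im w \<le> D" "0 < D"
    using Im_add_le_cmod_diff_cnj[of z w] z w by (auto simp: D_def)
  have zw: "0 < cmod z" "0 < cmod w" using z w by (auto intro!: complex_neq_0[THEN iffD1] simp: complex_eq_iff)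
  define a where "a = ln (D / Im z)"
  define b where "b = ln (D / Im w)"
  have ab: "0 \<le> a" "0 \<le> b" using D z w by (auto simp: a_def b_def)
  have rho: "ln (D\<^sup>2 / (Im z * Im w)) = a + b"
    using D z w by (simp add: a_def b_def ln_div ln_mult power2_eq_square)
  have 1: "ln_plus (1 / Im z) \<le> ln_plus (1 / Im w) + a"
  proof -
    have "ln (1 / Im z) \<le> ln (1 / Im w) + a"
      using D z w by (simp add: a_def ln_div)
    then show ?thesis using ab by (auto simp: ln_plus_def max_def)
  qed
  have 2: "ln_plus (cmod z) \<le> ln_plus (cmod w) + ln 2 + b"
  proof -
    have "cmod z \<le> cmod (z - cnj w) + cmod w"
      using norm_triangle_ineq[of "z - cnj w" "cnj w"] by simp
    also have "\<dots> = cmod w * 1 + D" by (simp add: D_def)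
    \<comment> \<open>Both terms are at most |w| * (D / Im w): the first since D >= Im w, the second
      since |w| >= Im w.\<close>
    also have "\<dots> \<le> cmod w * (D / Im w) + cmod w * (D / Im w)"
    proof (intro add_mono mult_left_mono)
      show "1 \<le> D / Im w" using D w by simp
      have "D = Im w * (D / Im w)" using w by simp
      also have "\<dots> \<le> cmod w * (D / Im w)"
        using abs_Im_le_cmod[of w] w D by (intro mult_right_mono) auto
      finally show "D \<le> cmod w * (D / Im w)" .
    qed auto
    finally have "cmod z \<le> 2 * (cmod w * (D / Im w))" by (simp add: mult_ac)
    then have "ln (cmod z) \<le> ln (2 * (cmod w * (D / Im w)))"
      using zw D w by (subst ln_le_cancel_iff) auto
    also have "\<dots> = ln 2 + (ln (cmod w) + b)"
      using zw D w by (simp add: b_def ln_mult ln_div)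
    finally show ?thesis using ab ln_ge_zero[of "2::real"] by (auto simp: ln_plus_def max_def)
  qed
  have "ln 2 \<le> (1::real)" using ln_2_less_1 by simp
  then have "omega z \<le> omega w + (1 + 2 * (a + b))"
    using 1 2 ab by (simp add: omega_def)
  also have "\<dots> \<le> omega w + omega w * (1 + 2 * (a + b))"
    using mult_right_mono[OF omega_ge_1[of w], of "1 + 2 * (a + b)"] ab by simp
  finally show ?thesis using rho by (simp add: D_def algebra_simps)
qed

text \<open>This is ln x <= x - 1 at x = t powr d. The exponent may be as small as desired, at the
  price of the constant 1/d.\<close>

lemma one_plus_ln_le_powr:
  fixes t d :: real
  assumes t: "1 \<le> t" and d: "0 < d" "d \<le> 1"
  shows "1 + ln t \<le> t powr d / d"
proof -
  have "d * ln t \<le> t powr d - 1"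
    using ln_le_minus_one[of "t powr d"] t by (simp add: ln_powr)
  then have "d * (1 + ln t) \<le> t powr d"
    using d by (simp add: algebra_simps)
  then show ?thesis using d by (simp add: field_simps)
qed

text \<open>The logarithm of \<open>\<bar>z - cnj w\<bar>\<^sup>2 / (Im z * Im w)\<close> is essentially the hyperbolic distance,
  with respect to which \<open>omega\<close> is Lipschitz.\<close>
lemma omega_powr_le:
  fixes s :: real
  obtains C where "0 < C" and
    "\<And>z w. \<lbrakk>0 < Im z; 0 < Im w\<rbrakk> \<Longrightarrow>
      omega z powr s \<le> C * omega w powr s * (cmod (z - cnj w) / sqrt (Im z * Im w))"
proof -
  \<comment> \<open>Raising to the power |s| turns the exponent d into d * |s|, which must stay
    below 1/2 because rho powr (1/2) is the ratio in the claim. The summand 1 keeps d finite at s =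
    0.\<close>
  define d where "d = 1 / (2 * (\<bar>s\<bar> + 1))"
  have d: "0 < d" "d \<le> 1" "d * \<bar>s\<bar> \<le> 1 / 2" by (auto simp: d_def field_simps)
  define C where "C = (2 / d) powr \<bar>s\<bar>"
  have main: "omega z powr s \<le> C * omega w powr s * (cmod (z - cnj w) / sqrt (Im z * Im w))"
    if z: "0 < Im z" and w: "0 < Im w" for z w
  proof -
    define \<rho> where "\<rho> = (cmod (z - cnj w))\<^sup>2 / (Im z * Im w)"
    have "Im z * Im w \<le> cmod (z - cnj w) * cmod (z - cnj w)"
      using Im_add_le_cmod_diff_cnj[of z w] z w by (intro mult_mono) auto
    then have rho: "1 \<le> \<rho>"
      using z w by (simp add: \<rho>_def power2_eq_square)
    have sqrt_rho: "\<rho> powr (1/2) = cmod (z - cnj w) / sqrt (Im z * Im w)"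
      using rho z w by (simp add: powr_half_sqrt real_sqrt_divide \<rho>_def)
    define Q where "Q = 2 / d * \<rho> powr d"
    have 1: "2 + 2 * ln \<rho> \<le> Q"
      using one_plus_ln_le_powr[OF rho d(1,2)] by (simp add: Q_def)
    have Q0: "0 < Q" using d rho by (simp add: Q_def)
    have zw: "omega z \<le> omega w * Q"
      using order_trans[OF omega_le_mult_ln[OF z w, folded \<rho>_def] mult_left_mono[OF 1]]
        omega_ge_1[of w] by simp
    have "omega w \<le> omega z * (2 + 2 * ln \<rho>)"
      using omega_le_mult_ln[OF w z] by (simp add: \<rho>_def cmod_diff_cnj_commute[of w] mult.commute)
    then have wz: "omega w \<le> omega z * Q"
      using order_trans[OF _ mult_left_mono[OF 1]] omega_ge_1[of z] by simp
    have pos: "0 < omega z" "0 < omega w" using omega_ge_1[of z] omega_ge_1[of w] by auto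
    \<comment> \<open>For s >= 0 the bound of \<open>omega z\<close> by \<open>omega w\<close> is
      raised to the power s; for s < 0 the reverse bound is raised to the power -s and
      inverted.\<close>
    have "omega z powr s \<le> omega w powr s * Q powr \<bar>s\<bar>"
    proof (cases "0 \<le> s")
      case True
      then show ?thesis
        using powr_mono2[OF True _ zw] pos Q0 by (simp add: powr_mult)
    next
      case False
      then have "omega w powr (-s) \<le> omega z powr (-s) * Q powr (-s)"
        using powr_mono2[OF _ _ wz, of "-s"] pos Q0 by (simp add: powr_mult)
      then show ?thesis
        using False pos Q0 by (simp add: powr_minus field_simps)
    qed
    also have "Q powr \<bar>s\<bar> = C * \<rho> powr (d * \<bar>s\<bar>)"
      unfolding Q_def C_def powr_mult[of "2 / d"] powr_powr ..
    also have "omega w powr s * (C * \<rho> powr (d * \<bar>s\<bar>)) \<le> omega w powr s * (C * \<rho> powr (1/2))"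
      using d rho by (intro mult_left_mono powr_mono) (auto simp: C_def)
    finally show ?thesis by (simp add: sqrt_rho mult_ac)
  qed
  have "0 < C" using d by (simp add: C_def)
  then show thesis using that main by blast
qed

section \<open>Measurability, and integration over horizontal and vertical lines\<close>

lemma omega_measurable [measurable]: "omega \<in> borel_measurable borel"
proof -
  have "omega = (\<lambda>z. 1 + max (ln (1 / Im z)) 0 + max (ln (cmod z)) 0)"
    by (auto simp: omega_def ln_plus_def)
  also have "\<dots> \<in> borel_measurable borel"
    by measurable
  finally show ?thesis .
qed

lemma uhp_sets [measurable]: "upper_half_plane \<in> sets borel"
  using open_upper_half_plane by simp

text \<open>Lebesgue measure is determined by its values on boxes, and a box in the plane pulls back
  to a product of intervals of the same area. This opens the way to Fubini and Tonelli in the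
  coordinates Re and Im.\<close>

lemma lborel_complex_eq_distr:
  "(lborel :: complex measure) = distr (lborel \<Otimes>\<^sub>M lborel) borel (\<lambda>(x, y). Complex x y)"
proof (rule lborel_eqI)
  have meas: "(\<lambda>(x, y). Complex x y) \<in> borel_measurable (lborel \<Otimes>\<^sub>M lborel)"
    by (simp add: Complex_eq split_beta')
  fix l u :: complex
  assume le: "\<And>b. b \<in> Basis \<Longrightarrow> l \<bullet> b \<le> u \<bullet> b"
  have le': "Re l \<le> Re u" "Im l \<le> Im u"
    using le[of 1] le[of \<i>] by (auto simp: Basis_complex_def inner_complex_def)
  have "(\<lambda>(x, y). Complex x y) -` box l u \<inter> space (lborel \<Otimes>\<^sub>M lborel)
      = {Re l<..<Re u} \<times> {Im l<..<Im u}"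
    by (auto simp: in_box_complex_iff space_pair_measure)
  then have "emeasure (distr (lborel \<Otimes>\<^sub>M lborel) borel (\<lambda>(x, y). Complex x y)) (box l u)
      = emeasure (lborel \<Otimes>\<^sub>M lborel) ({Re l<..<Re u} \<times> {Im l<..<Im u})"
    by (subst emeasure_distr[OF meas]) auto
  also have "\<dots> = ennreal (Re u - Re l) * ennreal (Im u - Im l)"
    using le' by (subst lborel.emeasure_pair_measure_Times) auto
  also have "\<dots> = ennreal (\<Prod>b\<in>Basis. (u - l) \<bullet> b)"
    using le' by (simp add: Basis_complex_def inner_complex_def ennreal_mult)
  finally show "emeasure (distr (lborel \<Otimes>\<^sub>M lborel) borel (\<lambda>(x, y). Complex x y)) (box l u)
      = ennreal (\<Prod>b\<in>Basis. (u - l) \<bullet> b)" .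
qed simp

lemma Complex_measurable [measurable]:
  "(\<lambda>(x, y). Complex x y) \<in> borel_measurable (lborel \<Otimes>\<^sub>M lborel)"
  by (simp add: Complex_eq split_beta')

lemma nn_integral_complex:
  assumes [measurable]: "f \<in> borel_measurable borel"
  shows "(\<integral>\<^sup>+z. f z \<partial>lborel) = (\<integral>\<^sup>+y. \<integral>\<^sup>+x. f (Complex x y) \<partial>lborel \<partial>lborel)"
proof -
  have "(\<integral>\<^sup>+z. f z \<partial>lborel) = (\<integral>\<^sup>+(x, y). f (Complex x y) \<partial>(lborel \<Otimes>\<^sub>M lborel))"
    by (subst lborel_complex_eq_distr, subst nn_integral_distr) (auto simp: split_beta')
  also have "\<dots> = (\<integral>\<^sup>+y. \<integral>\<^sup>+x. f (Complex x y) \<partial>lborel \<partial>lborel)"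
    by (subst lborel_pair.nn_integral_snd[symmetric]) (auto simp: split_beta' Complex_eq)
  finally show ?thesis .
qed

lemma nn_integral_complex':
  assumes [measurable]: "f \<in> borel_measurable borel"
  shows "(\<integral>\<^sup>+z. f z \<partial>lborel) = (\<integral>\<^sup>+x. \<integral>\<^sup>+y. f (Complex x y) \<partial>lborel \<partial>lborel)"
  unfolding nn_integral_complex[OF assms]
  by (subst lborel_pair.Fubini') (auto simp: split_beta' Complex_eq)

lemma
  fixes f :: "complex \<Rightarrow> complex"
  assumes f: "integrable lborel f"
  shows integrable_complex_slice: "integrable lborel (\<lambda>y. LBINT x. f (Complex x y))"
    and integral_complex_slice: "(LBINT z. f z) = (LBINT y. LBINT x. f (Complex x y))"
proof -
  have [measurable]: "f \<in> borel_measurable borel" using f by auto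
  have i: "integrable (lborel \<Otimes>\<^sub>M lborel) (\<lambda>(x, y). f (Complex x y))"
    using f unfolding lborel_complex_eq_distr
    by (subst (asm) integrable_distr_eq) (auto simp: split_beta')
  show "integrable lborel (\<lambda>y. LBINT x. f (Complex x y))"
    using lborel_pair.integrable_snd[OF i] by simp
  have "(LBINT z. f z) = (\<integral>(x, y). f (Complex x y) \<partial>(lborel \<Otimes>\<^sub>M lborel))"
    by (subst lborel_complex_eq_distr, subst integral_distr) (auto simp: split_beta')
  also have "\<dots> = (LBINT y. LBINT x. f (Complex x y))"
    using lborel_pair.integral_snd[OF i] by simp
  finally show "(LBINT z. f z) = (LBINT y. LBINT x. f (Complex x y))" .
qed

subsection \<open>The cubic kernel\<close>

text \<open>The Poisson integral: |z - cnj w|^-2 restricted to a horizontal line has this form, with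
  a = Im z + Im w.\<close>

lemma nn_integral_inverse_quadratic:
  fixes a u :: real
  assumes a: "0 < a"
  shows "(\<integral>\<^sup>+x. ennreal (1 / ((x - u)\<^sup>2 + a\<^sup>2)) \<partial>lborel) = ennreal (pi / a)"
proof -
  define F where "F = (\<lambda>x. arctan ((x - u) / a) / a)"
  have nz: "(x - u)\<^sup>2 + a\<^sup>2 \<noteq> 0" for x
    using a by (simp add: sum_power2_eq_zero_iff)
  have F: "(F has_real_derivative 1 / ((x - u)\<^sup>2 + a\<^sup>2)) (at x)" for x
  proof -
    have "1 + ((x - u) / a)\<^sup>2 = ((x - u)\<^sup>2 + a\<^sup>2) / a\<^sup>2"
      using a by (simp add: field_simps)
    then have "inverse (1 + ((x - u) / a)\<^sup>2) * (1 / a) / a = 1 / ((x - u)\<^sup>2 + a\<^sup>2)"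
      using a by (simp add: power2_eq_square)
    moreover have "(F has_real_derivative inverse (1 + ((x - u) / a)\<^sup>2) * (1 / a) / a) (at x)"
      unfolding F_def using a by (auto intro!: derivative_eq_intros)
    ultimately show ?thesis by simp
  qed
  have lim: "((F \<circ> real_of_ereal) \<longlongrightarrow> - pi / 2 / a) (at_right (-\<infinity>))"
    "((F \<circ> real_of_ereal) \<longlongrightarrow> pi / 2 / a) (at_left \<infinity>)"
    unfolding ereal_tendsto_simps F_def using a by (real_asymp; simp add: field_simps)+
  have "set_integrable lborel (einterval (-\<infinity>) \<infinity>) (\<lambda>x. 1 / ((x - u)\<^sup>2 + a\<^sup>2))"
    by (rule interval_integral_FTC_nonneg(1)[OF _ F _ _ lim]) (use nz in \<open>auto intro!: continuous_intros\<close>)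
  moreover have "(LBINT x=-\<infinity>..\<infinity>. 1 / ((x - u)\<^sup>2 + a\<^sup>2)) = pi / 2 / a - (- pi / 2 / a)"
    by (rule interval_integral_FTC_nonneg(2)[OF _ F _ _ lim]) (use nz in \<open>auto intro!: continuous_intros\<close>)
  ultimately have "integrable lborel (\<lambda>x. 1 / ((x - u)\<^sup>2 + a\<^sup>2))"
    and "(LBINT x. 1 / ((x - u)\<^sup>2 + a\<^sup>2)) = pi / a"
    by (simp_all add: set_integrable_def interval_lebesgue_integral_def set_lebesgue_integral_def)
  then show ?thesis by (subst nn_integral_eq_integral) auto
qed

text \<open>This is the vertical integral left over after the horizontal ones. The substitution y =
  v * t^2 reduces it to 2 / (sqrt v * (1 + t^2)), hence the primitive \<open>F\<close>.\<close>

lemma nn_integral_inverse_sqrt: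
  fixes v :: real
  assumes v: "0 < v"
  shows "(\<integral>\<^sup>+y. indicator {0<..} y * ennreal (1 / (sqrt y * (y + v))) \<partial>lborel) = ennreal (pi / sqrt v)"
proof -
  define f where "f = (\<lambda>y. 1 / (sqrt y * (y + v)))"
  define F where "F = (\<lambda>y. 2 / sqrt v * arctan (sqrt (y / v)))"
  have F: "(F has_real_derivative f y) (at y)" if "0 < y" for y
  proof -
    have "((\<lambda>y. sqrt (y / v)) has_real_derivative inverse (sqrt (y / v)) / 2 * (1 / v)) (at y)"
      using that v by (intro DERIV_chain2[OF DERIV_real_sqrt]) (auto intro!: derivative_eq_intros)
    then have "(F has_real_derivative 2 / sqrt v * (inverse (1 + (sqrt (y / v))\<^sup>2) * (inverse (sqrt (y / v)) / 2 * (1 / v)))) (at y)"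
      unfolding F_def by (intro DERIV_cmult DERIV_chain2[OF DERIV_arctan])
    also have "2 / sqrt v * (inverse (1 + (sqrt (y / v))\<^sup>2) * (inverse (sqrt (y / v)) / 2 * (1 / v))) = f y"
    proof -
      have "1 + (sqrt (y / v))\<^sup>2 = (y + v) / v"
        using that v by (simp add: field_simps)
      then show ?thesis
        using that v by (simp add: f_def real_sqrt_divide)
    qed
    finally show ?thesis .
  qed
  have lim: "((F \<circ> real_of_ereal) \<longlongrightarrow> 0) (at_right 0)"
    "((F \<circ> real_of_ereal) \<longlongrightarrow> pi / sqrt v) (at_left \<infinity>)"
    unfolding zero_ereal_def ereal_tendsto_simps F_def using v by (real_asymp; simp add: sqrt_def)+
  have cont: "isCont f y" if "0 < y" for y
    unfolding f_def using that v by (intro continuous_intros) auto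
  have "set_integrable lborel (einterval 0 \<infinity>) f"
    by (rule interval_integral_FTC_nonneg(1)[OF _ F cont _ lim]) (use v in \<open>auto simp: f_def\<close>)
  moreover have "(LBINT y=0..\<infinity>. f y) = pi / sqrt v - 0"
    by (rule interval_integral_FTC_nonneg(2)[OF _ F cont _ lim]) (use v in \<open>auto simp: f_def\<close>)
  ultimately have "integrable lborel (\<lambda>y. indicator {0<..} y * f y)"
    and "(LBINT y. indicator {0<..} y * f y) = pi / sqrt v"
    by (simp_all add: set_integrable_def interval_lebesgue_integral_def set_lebesgue_integral_def einterval_eq_Ici zero_ereal_def)
  then have "(\<integral>\<^sup>+y. ennreal (indicator {0<..} y * f y) \<partial>lborel) = ennreal (pi / sqrt v)"
    using v by (subst nn_integral_eq_integral) (auto simp: f_def indicator_def)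
  moreover have "(\<integral>\<^sup>+y. ennreal (indicator {0<..} y * f y) \<partial>lborel)
      = (\<integral>\<^sup>+y. indicator {0<..} y * ennreal (1 / (sqrt y * (y + v))) \<partial>lborel)"
    by (intro nn_integral_cong) (auto simp: f_def indicator_def)
  ultimately show ?thesis by simp
qed

text \<open>The horizontal integrals give pi / (y + Im w), the vertical one another pi / sqrt (Im
  w). This is the model integral to which all weighted kernel norms are reduced.\<close>

lemma nn_integral_kernel_half:
  assumes w: "0 < Im w"
  shows "(\<integral>\<^sup>+z. indicator upper_half_plane z * ennreal (1 / (sqrt (Im z) * (cmod (z - cnj w))\<^sup>2)) \<partial>lborel)
    = ennreal (pi\<^sup>2 / sqrt (Im w))"
proof -
  have "(\<integral>\<^sup>+x. indicator upper_half_plane (Complex x y) *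
      ennreal (1 / (sqrt (Im (Complex x y)) * (cmod (Complex x y - cnj w))\<^sup>2)) \<partial>lborel)
      = ennreal pi * (indicator {0<..} y * ennreal (1 / (sqrt y * (y + Im w))))" for y
  proof (cases "0 < y")
    case True
    have "indicator upper_half_plane (Complex x y) *
        ennreal (1 / (sqrt (Im (Complex x y)) * (cmod (Complex x y - cnj w))\<^sup>2))
        = ennreal (1 / sqrt y) * ennreal (1 / ((x - Re w)\<^sup>2 + (y + Im w)\<^sup>2))" for x
      using True by (simp add: uhp_iff cmod_power2 ennreal_mult'[symmetric])
    then have "(\<integral>\<^sup>+x. indicator upper_half_plane (Complex x y) *
      ennreal (1 / (sqrt (Im (Complex x y)) * (cmod (Complex x y - cnj w))\<^sup>2)) \<partial>lborel)
      = ennreal (1 / sqrt y) * ennreal (pi / (y + Im w))"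
      using True w by (simp add: nn_integral_cmult nn_integral_inverse_quadratic)
    also have "\<dots> = ennreal pi * (indicator {0<..} y * ennreal (1 / (sqrt y * (y + Im w))))"
      using True w by (simp add: ennreal_mult'[symmetric])
    finally show ?thesis .
  qed (simp add: uhp_iff)
  then show ?thesis
    using w by (subst nn_integral_complex)
      (auto simp: nn_integral_cmult nn_integral_inverse_sqrt ennreal_mult'[symmetric] power2_eq_square)
qed

text \<open>Changing \<open>omega z\<close> into \<open>omega w\<close> cancels one of the three
  powers of |z - cnj w| and brings in 1 / sqrt (Im z * Im w). The model integral remains, and its 1
  / sqrt (Im w) joins the one just produced to give 1 / Im w.\<close>

lemma kernel_weighted_integral_le:
  fixes s :: real
  obtains C where "0 < C" and
    "\<And>w. 0 < Im w \<Longrightarrow> (\<integral>\<^sup>+z. indicator upper_half_plane z * ennreal (omega z powr s / cmod (z - cnj w) ^ 3) \<partial>lborel)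
      \<le> ennreal (C * omega w powr s / Im w)"
proof -
  obtain C where C: "0 < C" "\<And>z w. \<lbrakk>0 < Im z; 0 < Im w\<rbrakk> \<Longrightarrow>
      omega z powr s \<le> C * omega w powr s * (cmod (z - cnj w) / sqrt (Im z * Im w))"
    using omega_powr_le by blast
  have "(\<integral>\<^sup>+z. indicator upper_half_plane z * ennreal (omega z powr s / cmod (z - cnj w) ^ 3) \<partial>lborel)
      \<le> ennreal (C * pi\<^sup>2 * omega w powr s / Im w)" if w: "0 < Im w" for w
  proof -
    define c where "c = C * omega w powr s / sqrt (Im w)"
    have c: "0 \<le> c" using C w by (simp add: c_def)
    have "indicator upper_half_plane z * ennreal (omega z powr s / cmod (z - cnj w) ^ 3)
        \<le> ennreal c * (indicator upper_half_plane z * ennreal (1 / (sqrt (Im z) * (cmod (z - cnj w))\<^sup>2)))" for z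
    proof (cases "0 < Im z")
      case True
      then have D: "0 < cmod (z - cnj w)" using Im_add_le_cmod_diff_cnj[of z w] w by linarith
      have "omega z powr s / cmod (z - cnj w) ^ 3
          \<le> C * omega w powr s * (cmod (z - cnj w) / sqrt (Im z * Im w)) / cmod (z - cnj w) ^ 3"
        using C(2)[OF True w] D by (intro divide_right_mono) auto
      also have "\<dots> = c * (1 / (sqrt (Im z) * (cmod (z - cnj w))\<^sup>2))"
        using D by (simp add: c_def real_sqrt_mult power2_eq_square power3_eq_cube)
      finally show ?thesis
        using True c by (simp add: uhp_iff ennreal_mult'[symmetric] ennreal_leI)
    qed (simp add: uhp_iff)
    then have "(\<integral>\<^sup>+z. indicator upper_half_plane z * ennreal (omega z powr s / cmod (z - cnj w) ^ 3) \<partial>lborel)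
        \<le> ennreal c * ennreal (pi\<^sup>2 / sqrt (Im w))"
      unfolding nn_integral_kernel_half[OF w, symmetric]
      by (subst nn_integral_cmult[symmetric]) (auto intro!: nn_integral_mono)
    also have "\<dots> = ennreal (C * pi\<^sup>2 * omega w powr s / Im w)"
      using c w by (simp add: c_def ennreal_mult'[symmetric] mult_ac)
    finally show ?thesis .
  qed
  then show thesis using C(1) by (intro that[of "C * pi\<^sup>2"]) auto
qed

section \<open>The spaces \<open>A1 s\<close> as normed spaces\<close>

lemma holo_uhp_measurable:
  assumes "f holomorphic_on upper_half_plane"
  shows "(\<lambda>z. indicator upper_half_plane z *\<^sub>R f z) \<in> borel_measurable borel"
  using assms by (intro borel_measurable_continuous_on_indicator holomorphic_on_imp_continuous_on) auto

lemma holo_uhp_eq_indicator: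
  "f \<in> holo_uhp \<Longrightarrow> (\<lambda>z. indicator upper_half_plane z *\<^sub>R f z) = f"
  by (auto simp: holo_uhp_def indicator_def)

lemma holo_uhp_borel: "f \<in> holo_uhp \<Longrightarrow> f \<in> borel_measurable borel"
  using holo_uhp_measurable[of f] holo_uhp_eq_indicator[of f] by (simp add: holo_uhp_def)

lemma holo_uhp_outside: "f \<in> holo_uhp \<Longrightarrow> \<not> 0 < Im z \<Longrightarrow> f z = 0"
  by (simp add: holo_uhp_def uhp_iff)

lemma holo_uhp_set_integrand:
  assumes "f \<in> holo_uhp"
  shows "indicator upper_half_plane z * (cmod (f z) * omega z powr s) = cmod (f z) * omega z powr s"
  using holo_uhp_outside[OF assms] by (cases "0 < Im z") (auto simp: uhp_iff)

lemma A1_iff: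
  "f \<in> A1 s \<longleftrightarrow> f \<in> holo_uhp \<and> integrable lborel (\<lambda>z. cmod (f z) * omega z powr s)"
  by (auto simp: A1_def set_integrable_def holo_uhp_set_integrand)

lemma A1_norm_eq:
  "f \<in> holo_uhp \<Longrightarrow> A1_norm s f = (LBINT z. cmod (f z) * omega z powr s)"
  by (simp add: A1_norm_def set_lebesgue_integral_def holo_uhp_set_integrand)

text \<open>Membership and norm bound both follow from an estimate of the extended integral, so
  Tonelli's theorem can be used before integrability is known.\<close>

lemma A1I_nn_integral:
  assumes f: "f \<in> holo_uhp"
    and le: "(\<integral>\<^sup>+z. ennreal (cmod (f z) * omega z powr s) \<partial>lborel) \<le> ennreal B" and B: "0 \<le> B"
  shows "f \<in> A1 s" "A1_norm s f \<le> B"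
proof -
  note [measurable] = holo_uhp_borel[OF f]
  have int: "integrable lborel (\<lambda>z. cmod (f z) * omega z powr s)"
    using le by (intro integrableI_bounded) (auto simp: abs_mult intro: le_less_trans)
  then show "f \<in> A1 s" using f by (simp add: A1_iff)
  have "ennreal (A1_norm s f) \<le> ennreal B"
    using le unfolding A1_norm_eq[OF f] by (subst (asm) nn_integral_eq_integral[OF int]) auto
  then show "A1_norm s f \<le> B" using B by simp
qed

lemma ennreal_A1_norm:
  assumes "f \<in> A1 s"
  shows "ennreal (A1_norm s f) = (\<integral>\<^sup>+z. ennreal (cmod (f z) * omega z powr s) \<partial>lborel)"
  using assms by (subst nn_integral_eq_integral) (auto simp: A1_iff A1_norm_eq)

lemma A1_norm_nonneg: "f \<in> A1 s \<Longrightarrow> 0 \<le> A1_norm s f"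
  by (auto simp: A1_iff A1_norm_eq intro!: integral_nonneg_AE)

lemma holo_uhp_lincomb:
  "f \<in> holo_uhp \<Longrightarrow> h \<in> holo_uhp \<Longrightarrow> (\<lambda>z. a * f z + b * h z) \<in> holo_uhp"
  by (simp add: holo_uhp_def holomorphic_on_add holomorphic_on_mult)

lemma
  assumes f: "f \<in> A1 s" and h: "h \<in> A1 s"
  shows A1_lincomb: "(\<lambda>z. a * f z + b * h z) \<in> A1 s"
    and A1_norm_lincomb_le: "A1_norm s (\<lambda>z. a * f z + b * h z) \<le> cmod a * A1_norm s f + cmod b * A1_norm s h"
proof -
  have fh: "f \<in> holo_uhp" "h \<in> holo_uhp"
    and int: "integrable lborel (\<lambda>z. cmod (f z) * omega z powr s)"
      "integrable lborel (\<lambda>z. cmod (h z) * omega z powr s)"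
    using f h by (auto simp: A1_iff)
  note [measurable] = holo_uhp_borel[OF fh(1)] holo_uhp_borel[OF fh(2)]
  have le: "cmod (a * f z + b * h z) * omega z powr s
      \<le> cmod a * (cmod (f z) * omega z powr s) + cmod b * (cmod (h z) * omega z powr s)" for z
    using mult_right_mono[OF norm_triangle_ineq[of "a * f z" "b * h z"], of "omega z powr s"]
    by (simp add: norm_mult algebra_simps)
  have int2: "integrable lborel (\<lambda>z. cmod a * (cmod (f z) * omega z powr s) + cmod b * (cmod (h z) * omega z powr s))"
    using int by simp
  have int3: "integrable lborel (\<lambda>z. cmod (a * f z + b * h z) * omega z powr s)"
    by (rule Bochner_Integration.integrable_bound[OF int2]) (use le in \<open>auto simp: abs_mult\<close>)
  then show *: "(\<lambda>z. a * f z + b * h z) \<in> A1 s"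
    using fh by (simp add: A1_iff holo_uhp_lincomb)
  have "(LBINT z. cmod (a * f z + b * h z) * omega z powr s)
      \<le> (LBINT z. cmod a * (cmod (f z) * omega z powr s) + cmod b * (cmod (h z) * omega z powr s))"
    by (rule integral_mono[OF int3 int2 le])
  then show "A1_norm s (\<lambda>z. a * f z + b * h z) \<le> cmod a * A1_norm s f + cmod b * A1_norm s h"
    using int fh by (simp add: A1_norm_eq holo_uhp_lincomb)
qed

lemma A1_zero: "(\<lambda>z. 0) \<in> A1 s"
  by (simp add: A1_iff holo_uhp_def)

text \<open>Up to a constant this is the Bergman kernel of the half plane for the measure
  \<open>Im z dV\<close>: holomorphic in z, antiholomorphic in w. The value 0 off the half plane
  follows the convention of \<open>holo_uhp\<close>.\<close>

definition cubic_kernel :: "complex \<Rightarrow> complex \<Rightarrow> complex" where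
  "cubic_kernel w z = (if z \<in> upper_half_plane then 1 / (z - cnj w) ^ 3 else 0)"

lemma diff_cnj_neq_0: "0 < Im z \<Longrightarrow> 0 < Im w \<Longrightarrow> z \<noteq> cnj w"
  by (auto simp: complex_eq_iff)

lemma cubic_kernel_in_holo_uhp: "0 < Im w \<Longrightarrow> cubic_kernel w \<in> holo_uhp"
proof -
  assume w: "0 < Im w"
  have "(\<lambda>z. 1 / (z - cnj w) ^ 3) holomorphic_on upper_half_plane"
    using w by (intro holomorphic_intros) (auto simp: uhp_iff diff_cnj_neq_0)
  then have "cubic_kernel w holomorphic_on upper_half_plane"
    by (rule holomorphic_transform) (simp add: cubic_kernel_def)
  then show ?thesis by (simp add: holo_uhp_def cubic_kernel_def)
qed

lemma cubic_kernel_nn_integrand: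
  "ennreal (cmod (cubic_kernel w z) * omega z powr s)
    = indicator upper_half_plane z * ennreal (omega z powr s / cmod (z - cnj w) ^ 3)"
  by (simp add: cubic_kernel_def norm_divide norm_power)

lemma cubic_kernel_A1_norm_le:
  fixes s :: real
  obtains C where "0 < C" and "\<And>w. 0 < Im w \<Longrightarrow> cubic_kernel w \<in> A1 s"
    and "\<And>w. 0 < Im w \<Longrightarrow> A1_norm s (cubic_kernel w) \<le> C * omega w powr s / Im w"
proof -
  obtain C where C: "0 < C" "\<And>w. 0 < Im w \<Longrightarrow>
      (\<integral>\<^sup>+z. indicator upper_half_plane z * ennreal (omega z powr s / cmod (z - cnj w) ^ 3) \<partial>lborel)
      \<le> ennreal (C * omega w powr s / Im w)"
    using kernel_weighted_integral_le by blast
  have "cubic_kernel w \<in> A1 s \<and> A1_norm s (cubic_kernel w) \<le> C * omega w powr s / Im w"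
    if "0 < Im w" for w
    using A1I_nn_integral[OF cubic_kernel_in_holo_uhp[OF that], of s "C * omega w powr s / Im w"]
      C(2)[OF that] C(1) that by (simp add: cubic_kernel_nn_integrand)
  then show thesis using C(1) that by blast
qed

text \<open>The distance |z - cnj w| is at least \<open>Im w\<close> for every z, so moving w by at
  most \<open>Im w / 2\<close> changes it by at most half, uniformly in z. Factoring the difference
  of cubes then gives a relative error, that is, a multiple of the kernel itself.\<close>

lemma
  assumes w: "0 < Im w" and near: "cmod (v - w) \<le> Im w / 2"
  shows Im_near: "Im w / 2 \<le> Im v" "Im v \<le> 3 / 2 * Im w"
    and cubic_kernel_lipschitz: "cmod (cubic_kernel v z - cubic_kernel w z)
      \<le> 38 * (cmod (v - w) / Im w) * cmod (cubic_kernel w z)"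
proof -
  show v: "Im w / 2 \<le> Im v" "Im v \<le> 3 / 2 * Im w"
    using abs_Im_le_cmod[of "v - w"] near by auto
  show "cmod (cubic_kernel v z - cubic_kernel w z)
      \<le> 38 * (cmod (v - w) / Im w) * cmod (cubic_kernel w z)"
  proof (cases "0 < Im z")
    case True
    define a b where "a = z - cnj w" and "b = z - cnj v"
    define d where "d = cmod (v - w)"
    have ab: "b = a - cnj (v - w)" by (simp add: a_def b_def)
    have wa: "Im w \<le> cmod a" using Im_add_le_cmod_diff_cnj[of z w] True by (simp add: a_def)
    have nz: "a \<noteq> 0" "b \<noteq> 0"
      using diff_cnj_neq_0[of z w] diff_cnj_neq_0[of z v] True w v by (auto simp: a_def b_def)
    have d: "d \<le> cmod a / 2" "0 \<le> d" using near wa by (auto simp: d_def)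
    have b1: "cmod a / 2 \<le> cmod b"
      using norm_triangle_ineq2[of a "cnj (v - w)"] d by (simp add: ab d_def del: complex_cnj_diff)
    have b2: "cmod b \<le> 3 / 2 * cmod a"
      using norm_triangle_ineq4[of a "cnj (v - w)"] d by (simp add: ab d_def del: complex_cnj_diff)
    have "1 / b ^ 3 - 1 / a ^ 3 = (a - b) * (a\<^sup>2 + a * b + b\<^sup>2) / (a ^ 3 * b ^ 3)"
      using nz by (simp add: field_simps power2_eq_square power3_eq_cube)
    then have "cmod (1 / b ^ 3 - 1 / a ^ 3)
        = d * cmod (a\<^sup>2 + a * b + b\<^sup>2) / (cmod a ^ 3 * cmod b ^ 3)"
      by (simp add: norm_mult norm_divide norm_power ab d_def del: complex_cnj_diff)
    \<comment> \<open>19/4 = 1 + 3/2 + 9/4 comes from |b| <= 3/2 |a|, and 38 = 8 * 19/4 from |b| >=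
      |a| / 2.\<close>
    also have "\<dots> \<le> d * (19 / 4 * (cmod a)\<^sup>2) / (cmod a ^ 3 * (cmod a / 2) ^ 3)"
    proof (intro frac_le mult_left_mono mult_nonneg_nonneg)
      have "cmod (a\<^sup>2 + a * b + b\<^sup>2) \<le> (cmod a)\<^sup>2 + cmod a * cmod b + (cmod b)\<^sup>2"
        by (metis (no_types) norm_triangle_le norm_triangle_ineq add_right_mono norm_mult norm_power)
      also have "\<dots> \<le> (cmod a)\<^sup>2 + cmod a * (3 / 2 * cmod a) + (3 / 2 * cmod a)\<^sup>2"
        using b2 by (intro add_mono mult_left_mono power_mono) auto
      also have "\<dots> = 19 / 4 * (cmod a)\<^sup>2" by (simp add: power2_eq_square algebra_simps)
      finally show "cmod (a\<^sup>2 + a * b + b\<^sup>2) \<le> 19 / 4 * (cmod a)\<^sup>2" .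
      show "(cmod a / 2) ^ 3 \<le> cmod b ^ 3" using b1 by (intro power_mono) auto
    qed (use d nz in auto)
    also have "\<dots> = 38 * (d / cmod a) * (1 / cmod a ^ 3)"
      using nz by (simp add: power2_eq_square power3_eq_cube field_simps)
    also have "\<dots> \<le> 38 * (d / Im w) * (1 / cmod a ^ 3)"
      using wa w d nz by (intro mult_right_mono mult_left_mono divide_left_mono) auto
    finally show ?thesis
      using True by (simp add: cubic_kernel_def uhp_iff a_def b_def d_def norm_divide norm_power)
  qed (simp add: cubic_kernel_def uhp_iff)
qed

subsection \<open>An area bound for holomorphic functions\<close>

lemma contour_integral_linepath_same_Im:
  assumes ab: "a < b"
  shows "contour_integral (linepath (Complex a c) (Complex b c)) f = integral {a..b} (\<lambda>x. f (Complex x c))"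
proof -
  have "contour_integral (linepath (Complex a c) (Complex b c)) f =
         (Complex b c - Complex a c) * integral {0..1} (\<lambda>x. f (linepath (Complex a c) (Complex b c) x))"
    by (simp add: contour_integral_integral)
  also have "Complex b c - Complex a c = of_real (b - a)"
    by (simp add: Complex_eq)
  also have "integral {0..1} (\<lambda>x. f (linepath (Complex a c) (Complex b c) x)) =
             integral {0..(b - a) / (b - a)} (\<lambda>x. f (Complex (a + (b - a) * x) c))"
    using ab by (simp add: linepath_def Complex_eq scaleR_conv_of_real algebra_simps)
  also have "{0..(b - a) / (b - a)} = (\<lambda>x. x / (b - a)) ` {0..b - a}"
    using ab by simp
  also have "integral \<dots> (\<lambda>x. f (Complex (a + (b - a) * x) c)) =
             integral {a-a..b-a} (\<lambda>x. f (Complex (x + a) c)) / of_real (b - a)"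
    using ab by (subst integral_stretch_real) (auto simp: scaleR_conv_of_real add_ac)
  also have "\<dots> = integral {a..b} (\<lambda>x. f (Complex x c)) / of_real (b - a)"
    by (subst integral_shift_real_ivl) (rule refl)
  finally show ?thesis using ab by simp
qed

text \<open>The path runs counterclockwise, so the top and the left side are traversed against their
  coordinate and enter with a minus sign.\<close>

lemma contour_integral_rectpath:
  assumes ab: "a < b" "c < d"
    and f: "continuous_on (path_image (rectpath (Complex a c) (Complex b d))) f"
  shows "contour_integral (rectpath (Complex a c) (Complex b d)) f =
    integral {a..b} (\<lambda>x. f (Complex x c)) + \<i> * integral {c..d} (\<lambda>y. f (Complex b y))
    - integral {a..b} (\<lambda>x. f (Complex x d)) - \<i> * integral {c..d} (\<lambda>y. f (Complex a y))"
proof -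
  let ?l1 = "linepath (Complex a c) (Complex b c)" and ?l2 = "linepath (Complex b c) (Complex b d)"
    and ?l3 = "linepath (Complex b d) (Complex a d)" and ?l4 = "linepath (Complex a d) (Complex a c)"
  have r: "rectpath (Complex a c) (Complex b d) = ?l1 +++ ?l2 +++ ?l3 +++ ?l4"
    by (simp add: rectpath_def Let_def)
  have "f contour_integrable_on l" if "l \<in> {?l1, ?l2, ?l3, ?l4}" for l
    using that by (auto simp: r path_image_join intro!: contour_integrable_continuous_linepath
        continuous_on_subset[OF f])
  then have "contour_integral (rectpath (Complex a c) (Complex b d)) f
      = contour_integral ?l1 f + (contour_integral ?l2 f + (contour_integral ?l3 f + contour_integral ?l4 f))"
    unfolding r by (simp add: contour_integrable_join)
  also have "contour_integral ?l3 f = - contour_integral (linepath (Complex a d) (Complex b d)) f"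
    by (rule contour_integral_reverse_linepath)
      (auto simp: r path_image_join closed_segment_commute intro!: continuous_on_subset[OF f])
  also have "contour_integral ?l4 f = - contour_integral (linepath (Complex a c) (Complex a d)) f"
    by (rule contour_integral_reverse_linepath)
      (auto simp: r path_image_join closed_segment_commute intro!: continuous_on_subset[OF f])
  finally show ?thesis
    using ab by (simp add: contour_integral_linepath_same_Im
        contour_integral_linepath_same_Re[OF _ _ _ _ ab(2)])
qed

lemma continuous_on_slice_Re:
  "continuous_on S f \<Longrightarrow> (\<And>x. x \<in> A \<Longrightarrow> Complex x c \<in> S) \<Longrightarrow> continuous_on A (\<lambda>x. f (Complex x c))"
  by (rule continuous_on_compose2[of S f]) (auto simp: Complex_eq intro!: continuous_intros)

lemma continuous_on_slice_Im:
  "continuous_on S f \<Longrightarrow> (\<And>y. y \<in> A \<Longrightarrow> Complex c y \<in> S) \<Longrightarrow> continuous_on A (\<lambda>y. f (Complex c y))"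
  by (rule continuous_on_compose2[of S f]) (auto simp: Complex_eq intro!: continuous_intros)

text \<open>Contour integrals are expressed by the gauge integral and areas by the extended Lebesgue
  integral; this inequality passes from the first to the second.\<close>

lemma norm_integral_le_nn_integral:
  fixes g :: "real \<Rightarrow> complex"
  assumes cont: "continuous_on {a..b} g"
  shows "ennreal (cmod (integral {a..b} g)) \<le> (\<integral>\<^sup>+x. indicator {a..b} x * ennreal (cmod (g x)) \<partial>lborel)"
proof -
  have i: "set_integrable lborel {a..b} g"
    using cont by (rule borel_integrable_atLeastAtMost')
  have "ennreal (cmod (integral {a..b} g)) = ennreal (cmod (LBINT x. indicator {a..b} x *\<^sub>R g x))"
    using set_borel_integral_eq_integral(2)[OF i] by (simp add: set_lebesgue_integral_def)
  also have "\<dots> \<le> (\<integral>\<^sup>+x. ennreal (cmod (indicator {a..b} x *\<^sub>R g x)) \<partial>lborel)"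
    by (rule integral_norm_bound_ennreal) (use i in \<open>simp add: set_integrable_def\<close>)
  also have "\<dots> = (\<integral>\<^sup>+x. indicator {a..b} x * ennreal (cmod (g x)) \<partial>lborel)"
    by (intro nn_integral_cong) (auto simp: indicator_def)
  finally show ?thesis .
qed

text \<open>Averaging Cauchy's formula over the squares with half-side between \<open>R / 2\<close> and \<open>R\<close>
  bounds the value at the centre by the area integral.\<close>
lemma holomorphic_area_bound:
  fixes f :: "complex \<Rightarrow> complex" and p :: complex
  assumes R: "0 < R"
    and Q: "Q = cbox (Complex (Re p - R) (Im p - R)) (Complex (Re p + R) (Im p + R))"
    and f: "f holomorphic_on Q"
  shows "ennreal (R\<^sup>2 * cmod (f p)) \<le> 8 * (\<integral>\<^sup>+z. indicator Q z * ennreal (cmod (f z)) \<partial>lborel)"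
proof -
  define \<Phi> where "\<Phi> z = indicator Q z * ennreal (cmod (f z))" for z
  have contf: "continuous_on Q f" using f by (rule holomorphic_on_imp_continuous_on)
  have [measurable]: "\<Phi> \<in> borel_measurable borel"
  proof -
    have "(\<lambda>z. indicator Q z *\<^sub>R cmod (f z)) \<in> borel_measurable borel"
      using contf by (intro borel_measurable_continuous_on_indicator continuous_intros) (simp_all add: Q)
    then have "(\<lambda>z. ennreal (indicator Q z *\<^sub>R cmod (f z))) \<in> borel_measurable borel"
      by measurable
    also have "(\<lambda>z. ennreal (indicator Q z *\<^sub>R cmod (f z))) = \<Phi>"
      by (auto simp: \<Phi>_def indicator_def)
    finally show ?thesis .
  qed
  have slice [measurable]: "(\<lambda>x. \<Phi> (Complex x y)) \<in> borel_measurable borel"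
      "(\<lambda>x. \<Phi> (Complex y x)) \<in> borel_measurable borel" for y
    by (simp_all add: Complex_eq)
  define A where "A y = (\<integral>\<^sup>+x. \<Phi> (Complex x y) \<partial>lborel)" for y
  define B where "B x = (\<integral>\<^sup>+y. \<Phi> (Complex x y) \<partial>lborel)" for x
  have [measurable]: "A \<in> borel_measurable borel" "B \<in> borel_measurable borel"
    unfolding A_def B_def by (simp_all add: Complex_eq)
  have total: "(\<integral>\<^sup>+y. A y \<partial>lborel) = (\<integral>\<^sup>+z. \<Phi> z \<partial>lborel)" "(\<integral>\<^sup>+x. B x \<partial>lborel) = (\<integral>\<^sup>+z. \<Phi> z \<partial>lborel)"
    unfolding A_def B_def by (simp_all add: nn_integral_complex[of \<Phi>, symmetric] nn_integral_complex'[of \<Phi>, symmetric])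
  \<comment> \<open>On the boundary of the square of half-side r one has |z - p| >= r, so r times
    Cauchy's integrand is at most |f|. Each side integral is then bounded by the integral of |f|
    over the full chord of \<open>Q\<close>, which is \<open>A\<close> or \<open>B\<close>. The left
    side uses 2 * r >= R.\<close>
  have key: "ennreal (pi * R * cmod (f p)) \<le> A (Im p - r) + B (Re p + r) + A (Im p + r) + B (Re p - r)"
    if r: "R / 2 \<le> r" "r < R" for r
  proof -
    define a b c d where "a = Re p - r" and "b = Re p + r" and "c = Im p - r" and "d = Im p + r"
    have abcd: "a < b" "c < d" using r R by (auto simp: a_def b_def c_def d_def)
    define \<gamma> where "\<gamma> = rectpath (Complex a c) (Complex b d)"
    have p_in: "p \<in> box (Complex a c) (Complex b d)"
      using r R by (auto simp: in_box_complex_iff a_def b_def c_def d_def)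
    have img: "path_image \<gamma> \<subseteq> Q - {p}"
    proof -
      have "path_image \<gamma> = cbox (Complex a c) (Complex b d) - box (Complex a c) (Complex b d)"
        unfolding \<gamma>_def using abcd by (intro path_image_rectpath_cbox_minus_box) auto
      moreover have "cbox (Complex a c) (Complex b d) \<subseteq> Q"
        unfolding Q using r by (intro subsetI) (simp add: in_cbox_complex_iff a_def b_def c_def d_def)
      ultimately show ?thesis using p_in by blast
    qed
    have far: "r \<le> cmod (z - p)" if "z \<in> path_image \<gamma>" for z
    proof -
      have "Re z \<in> {a, b} \<or> Im z \<in> {c, d}"
        using that abcd by (auto simp: \<gamma>_def path_image_rectpath)
      then have "r \<le> \<bar>Re (z - p)\<bar> \<or> r \<le> \<bar>Im (z - p)\<bar>"
        by (auto simp: a_def b_def c_def d_def)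
      then show ?thesis using abs_Re_le_cmod[of "z - p"] abs_Im_le_cmod[of "z - p"] by linarith
    qed
    define h where "h z = f z / (z - p)" for z
    have conth: "continuous_on (path_image \<gamma>) h"
      unfolding h_def using img by (intro continuous_intros continuous_on_subset[OF contf]) auto
    have hbound: "r * cmod (h z) \<le> cmod (f z)" if "z \<in> path_image \<gamma>" for z
    proof -
      have "r * cmod (h z) \<le> cmod (z - p) * cmod (h z)" using far[OF that] by (intro mult_right_mono) auto
      also have "\<dots> = cmod (f z)" using img that by (auto simp: h_def norm_divide)
      finally show ?thesis .
    qed
    have "(h has_contour_integral 2 * pi * \<i> * winding_number \<gamma> p * f p) \<gamma>"
      unfolding h_def
    proof (rule Cauchy_integral_formula_convex_simple[OF _ f])
      show "p \<in> interior Q" unfolding Q using R by (simp add: interior_cbox in_box_complex_iff)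
    qed (use img in \<open>auto simp: Q \<gamma>_def\<close>)
    moreover have "winding_number \<gamma> p = 1"
      unfolding \<gamma>_def by (rule winding_number_rectpath[OF p_in])
    ultimately have "contour_integral \<gamma> h = 2 * pi * \<i> * f p"
      by (simp add: contour_integral_unique)
    then have eq: "2 * pi * \<i> * f p = integral {a..b} (\<lambda>x. h (Complex x c)) + \<i> * integral {c..d} (\<lambda>y. h (Complex b y))
        - integral {a..b} (\<lambda>x. h (Complex x d)) - \<i> * integral {c..d} (\<lambda>y. h (Complex a y))"
      using contour_integral_rectpath[OF abcd conth[unfolded \<gamma>_def]] by (simp add: \<gamma>_def)
    have horiz: "ennreal (r * cmod (integral {a..b} (\<lambda>x. h (Complex x t)))) \<le> A t" if t: "t \<in> {c, d}" for t
    proof -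
      have on: "Complex x t \<in> path_image \<gamma>" if "x \<in> {a..b}" for x
        using that t abcd by (auto simp: \<gamma>_def path_image_rectpath)
      have "ennreal (r * cmod (integral {a..b} (\<lambda>x. h (Complex x t))))
          = ennreal (cmod (integral {a..b} (\<lambda>x. of_real r * h (Complex x t))))"
        using r R by (simp add: norm_mult)
      also have "\<dots> \<le> (\<integral>\<^sup>+x. indicator {a..b} x * ennreal (cmod (of_real r * h (Complex x t))) \<partial>lborel)"
        by (rule norm_integral_le_nn_integral)
          (intro continuous_intros continuous_on_slice_Re[OF conth] on)
      also have "\<dots> \<le> A t"
        unfolding A_def
      proof (rule nn_integral_mono)
        fix x
        show "indicator {a..b} x * ennreal (cmod (of_real r * h (Complex x t))) \<le> \<Phi> (Complex x t)"
          using hbound[OF on, of x] img on[of x] r R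
          by (auto simp: \<Phi>_def indicator_def norm_mult intro!: ennreal_leI)
      qed
      finally show ?thesis .
    qed
    have vert: "ennreal (r * cmod (integral {c..d} (\<lambda>y. h (Complex t y)))) \<le> B t" if t: "t \<in> {a, b}" for t
    proof -
      have on: "Complex t y \<in> path_image \<gamma>" if "y \<in> {c..d}" for y
        using that t abcd by (auto simp: \<gamma>_def path_image_rectpath)
      have "ennreal (r * cmod (integral {c..d} (\<lambda>y. h (Complex t y))))
          = ennreal (cmod (integral {c..d} (\<lambda>y. of_real r * h (Complex t y))))"
        using r R by (simp add: norm_mult)
      also have "\<dots> \<le> (\<integral>\<^sup>+y. indicator {c..d} y * ennreal (cmod (of_real r * h (Complex t y))) \<partial>lborel)"
        by (rule norm_integral_le_nn_integral)
          (intro continuous_intros continuous_on_slice_Im[OF conth] on)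
      also have "\<dots> \<le> B t"
        unfolding B_def
      proof (rule nn_integral_mono)
        fix y
        show "indicator {c..d} y * ennreal (cmod (of_real r * h (Complex t y))) \<le> \<Phi> (Complex t y)"
          using hbound[OF on, of y] img on[of y] r R
          by (auto simp: \<Phi>_def indicator_def norm_mult intro!: ennreal_leI)
      qed
      finally show ?thesis .
    qed
    have "pi * R * cmod (f p) \<le> r * cmod (2 * pi * \<i> * f p)"
      using r R mult_right_mono[of R "2 * r" "cmod (f p)"] by (simp add: norm_mult)
    also have "\<dots> \<le> r * cmod (integral {a..b} (\<lambda>x. h (Complex x c))) + r * cmod (integral {c..d} (\<lambda>y. h (Complex b y)))
        + r * cmod (integral {a..b} (\<lambda>x. h (Complex x d))) + r * cmod (integral {c..d} (\<lambda>y. h (Complex a y)))"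
    proof -
      have "cmod (2 * pi * \<i> * f p) \<le> cmod (integral {a..b} (\<lambda>x. h (Complex x c))) + cmod (\<i> * integral {c..d} (\<lambda>y. h (Complex b y)))
        + cmod (integral {a..b} (\<lambda>x. h (Complex x d))) + cmod (\<i> * integral {c..d} (\<lambda>y. h (Complex a y)))"
        unfolding eq by (intro norm_triangle_le norm_triangle_le_diff add_right_mono order_refl)
      then show ?thesis
        using r R by (simp add: norm_mult flip: distrib_left)
    qed
    finally have "ennreal (pi * R * cmod (f p)) \<le> ennreal (r * cmod (integral {a..b} (\<lambda>x. h (Complex x c)))) + ennreal (r * cmod (integral {c..d} (\<lambda>y. h (Complex b y))))
        + ennreal (r * cmod (integral {a..b} (\<lambda>x. h (Complex x d)))) + ennreal (r * cmod (integral {c..d} (\<lambda>y. h (Complex a y))))"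
      using r R by (simp add: ennreal_leI flip: ennreal_plus)
    also have "\<dots> \<le> A c + B b + A d + B a"
      by (intro add_mono horiz vert) auto
    finally show ?thesis by (simp add: a_def b_def c_def d_def)
  qed
  have refl: "(\<integral>\<^sup>+r. g (t - r) \<partial>lborel) = (\<integral>\<^sup>+r. g r \<partial>lborel)" "(\<integral>\<^sup>+r. g (t + r) \<partial>lborel) = (\<integral>\<^sup>+r. g r \<partial>lborel)"
    if "g \<in> borel_measurable borel" for g :: "real \<Rightarrow> ennreal" and t
    using nn_integral_real_affine[OF that, of "-1" t] nn_integral_real_affine[OF that, of "1" t] by simp_all
  \<comment> \<open>Integration over r in an interval of length R / 2: each of the four sides sweeps
    parallel chords, each at most once, and so contributes at most the area integral. This gives pi
    * R^2 / 2 times |f p| on the left against a factor 4 on the right; doubling and pi >= 1 yield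
    the constant 8.\<close>
  have "ennreal (pi * R * cmod (f p)) * ennreal (R / 2)
      = (\<integral>\<^sup>+r. ennreal (pi * R * cmod (f p)) * indicator {R / 2..<R} r \<partial>lborel)"
    using R by (simp add: nn_integral_cmult)
  also have "\<dots> \<le> (\<integral>\<^sup>+r. A (Im p - r) + B (Re p + r) + A (Im p + r) + B (Re p - r) \<partial>lborel)"
    using key by (intro nn_integral_mono) (auto simp: indicator_def)
  also have "\<dots> = (1 + 1 + 1 + 1) * (\<integral>\<^sup>+z. \<Phi> z \<partial>lborel)"
    unfolding distrib_right mult_1 by (simp add: nn_integral_add refl total)
  also have "\<dots> = 4 * (\<integral>\<^sup>+z. \<Phi> z \<partial>lborel)"
    by simp
  finally have le: "ennreal (pi * R * cmod (f p)) * ennreal (R / 2) \<le> 4 * (\<integral>\<^sup>+z. \<Phi> z \<partial>lborel)" .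
  have "ennreal (R\<^sup>2 * cmod (f p)) \<le> ennreal (2 * (pi * R * cmod (f p) * (R / 2)))"
    using R pi_gt3 mult_right_mono[of 1 pi "R\<^sup>2 * cmod (f p)"] by (intro ennreal_leI) (simp add: power2_eq_square mult_ac)
  also have "\<dots> = 2 * (ennreal (pi * R * cmod (f p)) * ennreal (R / 2))"
    using R by (subst ennreal_mult[symmetric], simp, simp, subst ennreal_mult) auto
  also have "\<dots> \<le> 2 * (4 * (\<integral>\<^sup>+z. \<Phi> z \<partial>lborel))"
    by (intro mult_left_mono le) auto
  finally show ?thesis by (simp add: \<Phi>_def mult.assoc[symmetric])
qed

subsection \<open>The reproducing formula\<close>

lemma tendsto_LBINT_symmetric:
  fixes g :: "real \<Rightarrow> complex"
  assumes g: "integrable lborel g" and cont: "continuous_on UNIV g"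
  shows "(\<lambda>n. integral {u - real n..u + real n} g) \<longlonglongrightarrow> (LBINT x. g x)"
proof -
  have "(\<lambda>n. LBINT x. indicator {u - real n..u + real n} x *\<^sub>R g x) \<longlonglongrightarrow> (LBINT x. g x)"
  proof (rule integral_dominated_convergence[where w = "\<lambda>x. cmod (g x)"])
    show "AE x in lborel. (\<lambda>n. indicator {u - real n..u + real n} x *\<^sub>R g x) \<longlonglongrightarrow> g x"
    proof (rule AE_I2)
      fix x :: real
      have "\<forall>\<^sub>F n in sequentially. real n \<ge> \<bar>x - u\<bar>"
        by (rule eventually_sequentiallyI[of "nat \<lceil>\<bar>x - u\<bar>\<rceil>"]) linarith
      then have "\<forall>\<^sub>F n in sequentially. indicator {u - real n..u + real n} x *\<^sub>R g x = g x"
        by eventually_elim (auto simp: indicator_def)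
      then show "(\<lambda>n. indicator {u - real n..u + real n} x *\<^sub>R g x) \<longlonglongrightarrow> g x"
        by (rule tendsto_eventually)
    qed
  qed (use g in \<open>auto simp: indicator_def\<close>)
  moreover have "(LBINT x. indicator {u - real n..u + real n} x *\<^sub>R g x) = integral {u - real n..u + real n} g" for n
    using set_borel_integral_eq_integral(2)[OF borel_integrable_atLeastAtMost'[OF continuous_on_subset[OF cont]]]
    by (simp add: set_lebesgue_integral_def)
  ultimately show ?thesis by simp
qed

text \<open>The line is closed by a rectangle above it, of width 2R and height R. The only pole
  inside is p, of order 3, with residue F''(p) / 2. Since F grows at most linearly, the integrand is
  O(R^-2) on the three other sides, whose total length is O(R).\<close>

lemma LBINT_horizontal_line_cube:
  fixes F :: "complex \<Rightarrow> complex"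
  assumes F: "F holomorphic_on upper_half_plane"
    and y0: "0 < y0" "y0 < Im p"
    and bound: "\<And>z. y0 \<le> Im z \<Longrightarrow> cmod (F z) \<le> C * cmod (z + \<i>)"
  shows "(LBINT x. F (Complex x y0) / (Complex x y0 - p) ^ 3) = pi * \<i> * (deriv ^^ 2) F p"
proof -
  define H where "H z = F z / (z - p) ^ 3" for z
  define u a where "u = Re p" and "a = Im p - y0"
  have a: "0 < a" using y0 by (simp add: a_def)
  have C: "0 \<le> C"
    using order_trans[OF norm_ge_zero bound[of p]] y0
    by (auto simp: zero_le_mult_iff complex_eq_iff)
  have p: "0 < Im p" using y0 by simp
  have contH: "continuous_on (upper_half_plane - {p}) H"
    unfolding H_def using holomorphic_on_imp_continuous_on[OF F]
    by (intro continuous_intros) (auto intro: continuous_on_subset)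
  have holH: "H holomorphic_on upper_half_plane - {p}"
    unfolding H_def using F by (intro holomorphic_intros) (auto intro: holomorphic_on_subset)
  have cont_line: "continuous_on UNIV (\<lambda>x. H (Complex x y0))"
    using y0 by (intro continuous_on_slice_Re[OF contH]) (auto simp: uhp_iff)
  \<comment> \<open>At distance at least d from p, linear growth in |z + i| is linear growth in |z -
    p|, which leaves an inverse square. It is used with d = a for integrability on the line and with
    d = R / 2 on the far sides.\<close>
  have H_le: "cmod (H z) \<le> C * (1 + cmod (p + \<i>) / d) / (cmod (z - p))\<^sup>2"
    if "y0 \<le> Im z" "d \<le> cmod (z - p)" "0 < d" for z d
  proof -
    have zp: "0 < cmod (z - p)" using that by linarith
    have "cmod (z + \<i>) \<le> cmod (z - p) + cmod (p + \<i>)"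
      using norm_triangle_ineq[of "z - p" "p + \<i>"] by simp
    also have "\<dots> \<le> cmod (z - p) + cmod (z - p) * (cmod (p + \<i>) / d)"
      using mult_right_mono[OF that(2), of "cmod (p + \<i>)"] that(3) by (simp add: field_simps)
    also have "\<dots> = cmod (z - p) * (1 + cmod (p + \<i>) / d)"
      by (simp add: distrib_left)
    finally have "cmod (F z) \<le> C * (cmod (z - p) * (1 + cmod (p + \<i>) / d))"
      using order_trans[OF bound[OF that(1)] mult_left_mono[OF _ C]] by blast
    then have "cmod (H z) \<le> C * (cmod (z - p) * (1 + cmod (p + \<i>) / d)) / cmod (z - p) ^ 3"
      using zp by (simp add: H_def norm_divide norm_power divide_right_mono)
    also have "\<dots> = C * (1 + cmod (p + \<i>) / d) / (cmod (z - p))\<^sup>2"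
      using zp by (simp add: power2_eq_square power3_eq_cube)
    finally show ?thesis .
  qed
  have int: "integrable lborel (\<lambda>x. H (Complex x y0))"
  proof (rule Bochner_Integration.integrable_bound)
    have "integrable lborel (\<lambda>x. 1 / ((x - u)\<^sup>2 + a\<^sup>2))"
      using nn_integral_inverse_quadratic[OF a, of u] by (intro integrableI_nonneg) auto
    then show "integrable lborel (\<lambda>x. C * (1 + cmod (p + \<i>) / a) * (1 / ((x - u)\<^sup>2 + a\<^sup>2)))"
      by (rule integrable_mult_right)
    show "(\<lambda>x. H (Complex x y0)) \<in> borel_measurable lborel"
      using borel_measurable_continuous_onI[OF cont_line] by simp
    have "cmod (H (Complex x y0)) \<le> C * (1 + cmod (p + \<i>) / a) * (1 / ((x - u)\<^sup>2 + a\<^sup>2))" for x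
    proof -
      have "(cmod (Complex x y0 - p))\<^sup>2 = (x - u)\<^sup>2 + a\<^sup>2"
        by (simp add: cmod_power2 u_def a_def power2_commute)
      moreover have "a \<le> cmod (Complex x y0 - p)"
        using abs_Im_le_cmod[of "Complex x y0 - p"] by (simp add: a_def)
      ultimately show ?thesis using H_le[of "Complex x y0" a] a by simp
    qed
    then show "AE x in lborel. cmod (H (Complex x y0)) \<le> norm (C * (1 + cmod (p + \<i>) / a) * (1 / ((x - u)\<^sup>2 + a\<^sup>2)))"
      using order_trans[OF _ abs_ge_self] unfolding real_norm_def by blast
  qed
  \<comment> \<open>The bound R >= 2a keeps the top side at distance at least R / 2 from p, and R >=
    2|p + i| makes the factor in \<open>H_le\<close> at most 2. So the integrand is at most 8C / R^2
    on sides of lengths 2R, R and R, which sums to 32C / R.\<close>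
  have est: "cmod (integral {u - R..u + R} (\<lambda>x. H (Complex x y0)) - pi * \<i> * (deriv ^^ 2) F p) \<le> 32 * C / R"
    if R: "1 \<le> R" "2 * a \<le> R" "2 * cmod (p + \<i>) \<le> R" for R
  proof -
    define \<gamma> where "\<gamma> = rectpath (Complex (u - R) y0) (Complex (u + R) (y0 + R))"
    have p_in: "p \<in> box (Complex (u - R) y0) (Complex (u + R) (y0 + R))"
      using R a y0 by (auto simp: in_box_complex_iff u_def a_def)
    have img: "path_image \<gamma> = cbox (Complex (u - R) y0) (Complex (u + R) (y0 + R))
        - box (Complex (u - R) y0) (Complex (u + R) (y0 + R))"
      unfolding \<gamma>_def using R by (intro path_image_rectpath_cbox_minus_box) auto
    have cb: "cbox (Complex (u - R) y0) (Complex (u + R) (y0 + R)) \<subseteq> upper_half_plane"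
      using y0 by (auto simp: in_cbox_complex_iff uhp_iff)
    have img': "path_image \<gamma> \<subseteq> upper_half_plane - {p}"
      using img cb p_in by blast
    have "contour_integral \<gamma> H = 2 * pi * \<i> * (\<Sum>q\<in>{p}. winding_number \<gamma> q * residue H q)"
    proof (rule Residue_theorem[OF open_upper_half_plane _ _ holH])
      show "connected upper_half_plane"
        unfolding upper_half_plane_def by (intro convex_connected convex_halfspace_Im_gt)
      show "\<forall>z. z \<notin> upper_half_plane \<longrightarrow> winding_number \<gamma> z = 0"
        unfolding \<gamma>_def using cb R by (intro allI impI winding_number_rectpath_outside) auto
    qed (use img' in \<open>auto simp: \<gamma>_def\<close>)
    also have "(\<Sum>q\<in>{p}. winding_number \<gamma> q * residue H q) = winding_number \<gamma> p * residue H p"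
      by simp
    also have "winding_number \<gamma> p = 1" unfolding \<gamma>_def by (rule winding_number_rectpath[OF p_in])
    also have "residue H p = (deriv ^^ 2) F p / 2"
      using residue_holomorphic_over_power[OF open_upper_half_plane _ F, of p 2] p
      by (simp add: H_def[abs_def] uhp_iff numeral_3_eq_3 numeral_2_eq_2)
    finally have "contour_integral \<gamma> H = pi * \<i> * (deriv ^^ 2) F p"
      by simp
    moreover have "contour_integral \<gamma> H = integral {u - R..u + R} (\<lambda>x. H (Complex x y0))
        + \<i> * integral {y0..y0 + R} (\<lambda>y. H (Complex (u + R) y))
        - integral {u - R..u + R} (\<lambda>x. H (Complex x (y0 + R)))
        - \<i> * integral {y0..y0 + R} (\<lambda>y. H (Complex (u - R) y))"
      unfolding \<gamma>_def using R img'
      by (intro contour_integral_rectpath continuous_on_subset[OF contH]) (auto simp: \<gamma>_def)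
    ultimately have eq: "integral {u - R..u + R} (\<lambda>x. H (Complex x y0)) - pi * \<i> * (deriv ^^ 2) F p
        = integral {u - R..u + R} (\<lambda>x. H (Complex x (y0 + R)))
        + \<i> * integral {y0..y0 + R} (\<lambda>y. H (Complex (u - R) y))
        - \<i> * integral {y0..y0 + R} (\<lambda>y. H (Complex (u + R) y))"
      by (simp add: algebra_simps)
    have small: "cmod (H z) \<le> 8 * C / R\<^sup>2" if z: "y0 \<le> Im z" "R / 2 \<le> cmod (z - p)" for z
    proof -
      have "cmod (H z) \<le> C * (1 + cmod (p + \<i>) / (R / 2)) / (cmod (z - p))\<^sup>2"
        using z R by (intro H_le) auto
      also have "\<dots> \<le> C * 2 / (R / 2)\<^sup>2"
        using R C z by (intro frac_le mult_left_mono power_mono) auto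
      finally show ?thesis by (simp add: power2_eq_square)
    qed
    have 1: "cmod (integral {u - R..u + R} (\<lambda>x. H (Complex x (y0 + R)))) \<le> 8 * C / R\<^sup>2 * ((u + R) - (u - R))"
    proof (rule integral_bound)
      show "continuous_on {u - R..u + R} (\<lambda>x. H (Complex x (y0 + R)))"
        by (rule continuous_on_slice_Re[OF contH]) (use y0 R a in \<open>auto simp: uhp_iff a_def\<close>)
      show "cmod (H (Complex x (y0 + R))) \<le> 8 * C / R\<^sup>2" for x
        using abs_Im_le_cmod[of "Complex x (y0 + R) - p"] R a by (intro small) (auto simp: a_def)
    qed (use R in auto)
    have 2: "cmod (integral {y0..y0 + R} (\<lambda>y. H (Complex t y))) \<le> 8 * C / R\<^sup>2 * ((y0 + R) - y0)"
      if t: "t = u - R \<or> t = u + R" for t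
    proof (rule integral_bound)
      show "continuous_on {y0..y0 + R} (\<lambda>y. H (Complex t y))"
        by (rule continuous_on_slice_Im[OF contH]) (use t y0 R in \<open>auto simp: uhp_iff u_def\<close>)
      show "cmod (H (Complex t y)) \<le> 8 * C / R\<^sup>2" if "y \<in> {y0..y0 + R}" for y
        using abs_Re_le_cmod[of "Complex t y - p"] R t that by (intro small) (auto simp: u_def)
    qed (use R in auto)
    have "cmod (integral {u - R..u + R} (\<lambda>x. H (Complex x y0)) - pi * \<i> * (deriv ^^ 2) F p)
        \<le> cmod (integral {u - R..u + R} (\<lambda>x. H (Complex x (y0 + R))))
        + cmod (\<i> * integral {y0..y0 + R} (\<lambda>y. H (Complex (u - R) y)))
        + cmod (\<i> * integral {y0..y0 + R} (\<lambda>y. H (Complex (u + R) y)))"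
      unfolding eq by (intro norm_triangle_le_diff norm_triangle_le add_right_mono order_refl)
    also have "\<dots> \<le> 8 * C / R\<^sup>2 * ((u + R) - (u - R)) + 8 * C / R\<^sup>2 * ((y0 + R) - y0) + 8 * C / R\<^sup>2 * ((y0 + R) - y0)"
      unfolding norm_mult norm_ii mult_1 by (intro add_mono 1 2) auto
    also have "\<dots> = 32 * C / R" using R by (simp add: power2_eq_square field_simps)
    finally show ?thesis .
  qed
  have "(\<lambda>n. integral {u - real n..u + real n} (\<lambda>x. H (Complex x y0))) \<longlonglongrightarrow> pi * \<i> * (deriv ^^ 2) F p"
  proof (rule Lim_null[THEN iffD2], rule Lim_null_comparison)
    have "\<forall>\<^sub>F n in sequentially. real n \<ge> max 1 (max (2 * a) (2 * cmod (p + \<i>)))"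
      by (rule eventually_sequentiallyI[of "nat \<lceil>max 1 (max (2 * a) (2 * cmod (p + \<i>)))\<rceil>"]) linarith
    then show "\<forall>\<^sub>F n in sequentially. cmod (integral {u - real n..u + real n} (\<lambda>x. H (Complex x y0))
        - pi * \<i> * (deriv ^^ 2) F p) \<le> 32 * C / real n"
      by eventually_elim (rule est; linarith)
    show "(\<lambda>n. 32 * C / real n) \<longlonglongrightarrow> 0" by real_asymp
  qed
  with tendsto_LBINT_symmetric[OF int cont_line, of u]
  have "(LBINT x. H (Complex x y0)) = pi * \<i> * (deriv ^^ 2) F p"
    using LIMSEQ_unique by blast
  then show ?thesis by (simp add: H_def)
qed

text \<open>On the line \<open>Im z = y\<close> one has \<open>cnj z - w = z - (w + 2 * \<i> * y)\<close>, so the inner integral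
  is Cauchy's formula for a second derivative, and what is left is
  \<open>y * F'' (w + 2 * \<i> * y)\<close>, a total derivative in \<open>y\<close>.\<close>
theorem reproducing_formula:
  fixes F :: "complex \<Rightarrow> complex"
  assumes F: "F holomorphic_on upper_half_plane"
    and w: "0 < Im w"
    and bound: "\<And>y0. 0 < y0 \<Longrightarrow> \<exists>C. \<forall>z. y0 \<le> Im z \<longrightarrow> cmod (F z) \<le> C * cmod (z + \<i>) / Im z powr (3/2)"
    and int: "integrable lborel (\<lambda>z. indicator upper_half_plane z *\<^sub>R (F z * Im z / (cnj z - w) ^ 3))"
  shows "(LBINT z. indicator upper_half_plane z *\<^sub>R (F z * Im z / (cnj z - w) ^ 3)) = - (pi * \<i> / 4) * F w"
proof -
  let ?J = "\<lambda>z. indicator upper_half_plane z *\<^sub>R (F z * Im z / (cnj z - w) ^ 3)"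
  define P where "P y = w + 2 * \<i> * of_real y" for y
  define K where "K y = y * (deriv ^^ 2) F (P y)" for y
  have ImP: "Im (P y) = Im w + 2 * y" for y by (simp add: P_def)
  have slice: "(LBINT x. ?J (Complex x y)) = indicator {0<..} y *\<^sub>R (pi * \<i> * K y)" for y
  proof (cases "0 < y")
    case True
    obtain C where C: "\<And>z. y \<le> Im z \<Longrightarrow> cmod (F z) \<le> C * cmod (z + \<i>) / Im z powr (3/2)"
      using bound[OF True] by blast
    have C0: "0 \<le> C"
    proof -
      have "0 \<le> C * cmod (Complex 0 y + \<i>) / y powr (3/2)"
        using order_trans[OF norm_ge_zero C[of "Complex 0 y"]] by simp
      moreover have "0 < cmod (Complex 0 y + \<i>) / y powr (3/2)"
        using True by (simp add: complex_eq_iff)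
      ultimately show ?thesis
        by (metis times_divide_eq_right zero_le_mult_iff not_less)
    qed
    \<comment> \<open>Above a fixed height the power of \<open>Im z\<close> can be frozen at y,
      which leaves the linear growth required for the line integral.\<close>
    have C': "cmod (F z) \<le> C / y powr (3/2) * cmod (z + \<i>)" if "y \<le> Im z" for z
    proof -
      have "cmod (F z) \<le> C * cmod (z + \<i>) / Im z powr (3/2)" by (rule C[OF that])
      also have "\<dots> \<le> C * cmod (z + \<i>) / y powr (3/2)"
        using that True C0 by (intro divide_left_mono powr_mono2) auto
      finally show ?thesis by simp
    qed
    have "?J (Complex x y) = y * (F (Complex x y) / (Complex x y - P y) ^ 3)" for x
    proof -
      have "cnj (Complex x y) - w = Complex x y - P y"
        by (simp add: P_def complex_eq_iff)
      then show ?thesis using True by (simp add: uhp_iff)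
    qed
    then have "(LBINT x. ?J (Complex x y)) = y * (LBINT x. F (Complex x y) / (Complex x y - P y) ^ 3)"
      by (simp only: integral_mult_right_zero)
    also have "(LBINT x. F (Complex x y) / (Complex x y - P y) ^ 3) = pi * \<i> * (deriv ^^ 2) F (P y)"
      by (rule LBINT_horizontal_line_cube[OF F True _ C']) (use w True in \<open>auto simp: ImP\<close>)
    finally show ?thesis using True by (simp add: K_def mult_ac)
  qed (simp add: uhp_iff)
  have intK: "set_integrable lborel {0<..} K"
  proof -
    have "integrable lborel (\<lambda>y. indicator {0<..} y *\<^sub>R (pi * \<i> * K y))"
      using integrable_complex_slice[OF int] by (simp only: slice)
    then have "integrable lborel (\<lambda>y. (1 / (pi * \<i>)) * (indicator {0<..} y *\<^sub>R (pi * \<i> * K y)))"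
      by (rule integrable_mult_right)
    then show ?thesis by (simp add: set_integrable_def)
  qed
  have tot: "(LBINT z. ?J z) = pi * \<i> * (LBINT y:{0<..}. K y)"
    unfolding integral_complex_slice[OF int] slice mult_scaleR_right[symmetric] integral_mult_right_zero set_lebesgue_integral_def ..
  \<comment> \<open>Integration by parts in closed form: as P' = 2i, the subtracted F (P y) cancels
    the first-order term, and the derivative is (2i)^2 * y * F''(P y).\<close>
  define \<Psi> where "\<Psi> y = of_real y * (2 * \<i> * deriv F (P y)) - F (P y)" for y
  have P_uhp: "P y \<in> upper_half_plane" if "0 \<le> y" for y using that w by (simp add: ImP uhp_iff)
  have F1: "deriv F holomorphic_on upper_half_plane"
    using F open_upper_half_plane by (rule holomorphic_deriv)
  have F2: "(deriv ^^ 2) F holomorphic_on upper_half_plane"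
    using F open_upper_half_plane by (rule holomorphic_higher_deriv)
  have dP: "(P has_vector_derivative 2 * \<i>) (at y)" for y
    unfolding P_def by (auto intro!: derivative_eq_intros)
  have dF: "((\<lambda>y. F (P y)) has_vector_derivative 2 * \<i> * deriv F (P y)) (at y)" if "0 \<le> y" for y
    using field_vector_diff_chain_at[OF dP, of F] holomorphic_derivI[OF F open_upper_half_plane P_uhp[OF that]]
    by (simp add: o_def)
  have dF1: "((\<lambda>y. deriv F (P y)) has_vector_derivative 2 * \<i> * (deriv ^^ 2) F (P y)) (at y)" if "0 \<le> y" for y
    using field_vector_diff_chain_at[OF dP, of "deriv F"] holomorphic_derivI[OF F1 open_upper_half_plane P_uhp[OF that]]
    by (simp add: o_def numeral_2_eq_2)
  have d\<Psi>: "(\<Psi> has_vector_derivative - 4 * K y) (at y)" if "0 < y" for y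
    unfolding \<Psi>_def K_def
    by (rule derivative_eq_intros dF dF1 that less_imp_le refl)+ (simp add: algebra_simps)
  have contK: "isCont K y" if "0 < y" for y
  proof -
    have "isCont (\<lambda>y. (deriv ^^ 2) F (P y)) y"
      using has_vector_derivative_continuous[OF field_vector_diff_chain_at[OF dP
            holomorphic_derivI[OF F2 open_upper_half_plane P_uhp[OF less_imp_le[OF that]]]]]
      unfolding o_def .
    then show ?thesis unfolding K_def by (intro continuous_intros)
  qed
  have lim0: "((\<Psi> \<circ> real_of_ereal) \<longlongrightarrow> - F w) (at_right 0)"
  proof -
    have "isCont \<Psi> 0"
      unfolding \<Psi>_def using dF[of 0, THEN has_vector_derivative_continuous]
        dF1[of 0, THEN has_vector_derivative_continuous] by (intro continuous_intros) auto
    then have "(\<Psi> \<longlongrightarrow> \<Psi> 0) (at_right 0)"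
      using filterlim_at_split isCont_def by blast
    then show ?thesis unfolding zero_ereal_def ereal_tendsto_simps by (simp add: \<Psi>_def P_def)
  qed
  \<comment> \<open>The disc of radius y about P y stays above height Im w + y, so Cauchy's
    inequality bounds y * F' by the same \<open>M y\<close> as F. There the growth bound is of order
    y / y^(3/2): the exponent 3/2 beats the linear factor, and the boundary term at infinity
    vanishes.\<close>
  have liminf: "((\<Psi> \<circ> real_of_ereal) \<longlongrightarrow> 0) (at_left \<infinity>)"
  proof -
    obtain C where C: "\<And>z. Im w \<le> Im z \<Longrightarrow> cmod (F z) \<le> C * cmod (z + \<i>) / Im z powr (3/2)"
      using bound[OF w] by blast
    have C0: "0 \<le> C"
    proof -
      have "0 \<le> C * cmod (w + \<i>) / Im w powr (3/2)"
        using order_trans[OF norm_ge_zero C[of w]] by simp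
      moreover have "0 < cmod (w + \<i>) / Im w powr (3/2)"
        using w by (simp add: complex_eq_iff)
      ultimately show ?thesis
        by (metis times_divide_eq_right zero_le_mult_iff not_less)
    qed
    define M where "M y = C * (cmod (w + \<i>) + 3 * y) / y powr (3/2)" for y
    have Fball: "cmod (F z) \<le> M y" if y: "0 < y" and z: "cmod (P y - z) \<le> y" for y z
    proof -
      have "Im w + y \<le> Im z" using abs_Im_le_cmod[of "P y - z"] z by (simp add: ImP)
      then have Imz: "Im w \<le> Im z" "y \<le> Im z" using y w by auto
      have "cmod (z + \<i>) \<le> cmod (w + \<i>) + 3 * y"
      proof -
        have "z + \<i> = (w + \<i>) + 2 * \<i> * y - (P y - z)" by (simp add: P_def)
        also have "cmod \<dots> \<le> cmod (w + \<i>) + cmod (2 * \<i> * y) + cmod (P y - z)"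
          by (intro norm_triangle_le_diff norm_triangle_le add_right_mono order_refl)
        finally show ?thesis using z y by (simp add: norm_mult)
      qed
      then have "C * cmod (z + \<i>) / Im z powr (3/2) \<le> C * (cmod (w + \<i>) + 3 * y) / y powr (3/2)"
        using C0 y Imz by (intro frac_le mult_left_mono powr_mono2 mult_nonneg_nonneg) auto
      then show ?thesis using C[OF Imz(1)] by (simp add: M_def)
    qed
    have "cmod (\<Psi> y) \<le> 3 * M y" if y: "0 < y" for y
    proof -
      have cb: "cball (P y) y \<subseteq> upper_half_plane"
      proof
        fix z assume "z \<in> cball (P y) y"
        then show "z \<in> upper_half_plane"
          using abs_Im_le_cmod[of "P y - z"] y w by (auto simp: ImP uhp_iff dist_norm)
      qed
      have "cmod ((deriv ^^ 1) F (P y)) \<le> fact 1 * M y / y ^ 1"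
      proof (rule Cauchy_inequality[OF _ _ y])
        show "F holomorphic_on ball (P y) y"
          using cb ball_subset_cball by (blast intro: holomorphic_on_subset[OF F])
        show "continuous_on (cball (P y) y) F"
          using cb holomorphic_on_imp_continuous_on[OF F] continuous_on_subset by blast
      qed (use Fball[OF y] in auto)
      then have "y * cmod (deriv F (P y)) \<le> M y" using y by (simp add: field_simps)
      moreover have "cmod (\<Psi> y) \<le> 2 * (y * cmod (deriv F (P y))) + cmod (F (P y))"
        unfolding \<Psi>_def using norm_triangle_ineq4[of "of_real y * (2 * \<i> * deriv F (P y))" "F (P y)"] y
        by (simp add: norm_mult mult_ac)
      moreover have "cmod (F (P y)) \<le> M y" using Fball[OF y, of "P y"] y by simp
      ultimately show ?thesis by simp
    qed
    then have "\<forall>\<^sub>F y in at_top. norm (\<Psi> y) \<le> 3 * M y"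
      using eventually_gt_at_top[of 0] by (rule eventually_mono[rotated]) 
    moreover have "((\<lambda>y. 3 * M y) \<longlongrightarrow> 0) at_top"
      unfolding M_def by real_asymp
    ultimately have "(\<Psi> \<longlongrightarrow> 0) at_top" by (rule Lim_null_comparison)
    then show ?thesis unfolding ereal_tendsto_simps .
  qed
  have ivl: "einterval 0 \<infinity> = {0<..}" by (simp add: zero_ereal_def einterval_eq_Ici)
  have "(LBINT y=0..\<infinity>. - 4 * K y) = 0 - (- F w)"
  proof (rule interval_integral_FTC_integrable[OF _ d\<Psi> _ _ lim0 liminf])
    show "set_integrable lborel (einterval 0 \<infinity>) (\<lambda>y. - 4 * K y)"
      unfolding ivl using intK by (rule set_integrable_mult_right)
  qed (auto intro!: contK continuous_intros)
  then have "-4 * (LBINT y:{0<..}. K y) = F w"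
    unfolding interval_lebesgue_integral_def ivl set_integral_mult_right by simp
  from this[symmetric] have "(LBINT y:{0<..}. K y) = - F w / 4" by simp
  then show ?thesis unfolding tot by simp
qed

section \<open>Growth and reproduction of functions in \<open>A1 s\<close>\<close>

text \<open>On the square of half-side \<open>Im p / 2\<close> about p the weight is comparable with
  its value at p, so the unweighted area bound turns into a bound by the weighted norm. The constant
  collects 8 from the area bound, 5 from the weight and 4 from R^2 = Im p^2 / 4.\<close>

lemma A1_pointwise_bound:
  assumes f: "f \<in> A1 s"
  obtains C where "\<And>z. 0 < Im z \<Longrightarrow> cmod (f z) * omega z powr s \<le> C / Im z ^ 2"
proof -
  obtain C where C: "0 < C" "\<And>z w. \<lbrakk>0 < Im z; 0 < Im w\<rbrakk> \<Longrightarrow>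
      omega z powr s \<le> C * omega w powr s * (cmod (z - cnj w) / sqrt (Im z * Im w))"
    using omega_powr_le by blast
  have fh: "f \<in> holo_uhp" using f by (simp add: A1_iff)
  note [measurable] = holo_uhp_borel[OF fh]
  have "cmod (f p) * omega p powr s \<le> (160 * C * A1_norm s f) / Im p ^ 2" if p: "0 < Im p" for p
  proof -
    define R where "R = Im p / 2"
    define Q where "Q = cbox (Complex (Re p - R) (Im p - R)) (Complex (Re p + R) (Im p + R))"
    have R: "0 < R" using p by (simp add: R_def)
    have Qin: "\<bar>Re p - Re z\<bar> \<le> R \<and> R \<le> Im z \<and> Im z \<le> 3 * R" if "z \<in> Q" for z
    proof -
      have "Re p - R \<le> Re z" "Re z \<le> Re p + R" "Im p - R \<le> Im z" "Im z \<le> Im p + R" "Im p = 2 * R"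
        using that by (auto simp: Q_def in_cbox_complex_iff R_def)
      then show ?thesis by (intro conjI; linarith)
    qed
    have sub: "Q \<subseteq> upper_half_plane" using Qin R by (force simp: uhp_iff)
    have holo: "f holomorphic_on Q" using fh sub by (auto simp: holo_uhp_def intro: holomorphic_on_subset)
    \<comment> \<open>The numerator is at most R horizontally plus 2R + 3R vertically. The root is
      at least sqrt 2 * R; the smaller value 6/5 * R is taken because it makes the quotient exactly
      5.\<close>
    have comp: "omega p powr s \<le> 5 * C * omega z powr s" if z: "z \<in> Q" for z
    proof -
      have z0: "0 < Im z" using Qin[OF z] R by linarith
      have "cmod (p - cnj z) \<le> \<bar>Re (p - cnj z)\<bar> + \<bar>Im (p - cnj z)\<bar>" by (rule cmod_le)
      also have "\<dots> \<le> 6 * R" using Qin[OF z] R by (simp add: R_def)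
      finally have 1: "cmod (p - cnj z) \<le> 6 * R" .
      have 2: "(6 / 5) * R \<le> sqrt (Im p * Im z)"
      proof (rule real_le_rsqrt)
        have "((6 / 5) * R)\<^sup>2 \<le> (2 * R) * R" using R by (simp add: power2_eq_square)
        also have "\<dots> \<le> Im p * Im z" using Qin[OF z] R by (intro mult_mono) (auto simp: R_def)
        finally show "((6 / 5) * R)\<^sup>2 \<le> Im p * Im z" .
      qed
      have "cmod (p - cnj z) / sqrt (Im p * Im z) \<le> 6 * R / ((6 / 5) * R)"
        using 1 2 R by (intro frac_le) auto
      also have "\<dots> = 5" using R by simp
      finally have "C * omega z powr s * (cmod (p - cnj z) / sqrt (Im p * Im z)) \<le> C * omega z powr s * 5"
        using C by (intro mult_left_mono) auto
      then show ?thesis using C(2)[OF p z0] by (simp add: mult_ac)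
    qed
    have "ennreal (R\<^sup>2 * cmod (f p)) * ennreal (omega p powr s)
        \<le> 8 * (\<integral>\<^sup>+z. indicator Q z * ennreal (cmod (f z)) \<partial>lborel) * ennreal (omega p powr s)"
      by (intro mult_right_mono holomorphic_area_bound[OF R Q_def holo]) auto
    also have "\<dots> = 8 * (\<integral>\<^sup>+z. indicator Q z * ennreal (cmod (f z)) * ennreal (omega p powr s) \<partial>lborel)"
      by (subst nn_integral_multc) (auto simp: Q_def mult.assoc)
    also have "\<dots> \<le> 8 * (\<integral>\<^sup>+z. ennreal (5 * C) * ennreal (cmod (f z) * omega z powr s) \<partial>lborel)"
    proof (intro mult_left_mono nn_integral_mono)
      fix z
      show "indicator Q z * ennreal (cmod (f z)) * ennreal (omega p powr s)
          \<le> ennreal (5 * C) * ennreal (cmod (f z) * omega z powr s)"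
      proof (cases "z \<in> Q")
        case True
        then show ?thesis
          using mult_left_mono[OF comp[OF True], of "cmod (f z)"] C
          by (simp add: ennreal_mult'[symmetric] ennreal_leI mult_ac)
      qed simp
    qed simp
    also have "\<dots> = 8 * (ennreal (5 * C) * ennreal (A1_norm s f))"
      by (subst nn_integral_cmult) (auto simp: ennreal_A1_norm[OF f])
    also have "\<dots> = ennreal (40 * C * A1_norm s f)"
    proof -
      have "ennreal (8 * ((5 * C) * A1_norm s f)) = ennreal 8 * (ennreal (5 * C) * ennreal (A1_norm s f))"
        using C A1_norm_nonneg[OF f] by (subst ennreal_mult, simp, simp, subst ennreal_mult) auto
      then show ?thesis by (simp add: mult.assoc)
    qed
    finally have "R\<^sup>2 * cmod (f p) * omega p powr s \<le> 40 * C * A1_norm s f"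
      using C A1_norm_nonneg[OF f] by (simp add: ennreal_mult'[symmetric])
    then show ?thesis using p by (simp add: R_def field_simps)
  qed
  then show thesis using that by blast
qed

text \<open>Comparison with \<open>omega \<i>\<close> costs |z + i| / sqrt (Im z). One power of
  \<open>Im z\<close> is kept and joins the root to give 3/2, the other m are bounded by powers of
  y0. The case m = 1 serves \<open>A1\<close>, the case m = 0 derivatives of Bloch
  functions.\<close>

lemma omega_weighted_growth:
  assumes le: "\<And>z. 0 < Im z \<Longrightarrow> cmod (F z) * omega z powr s \<le> B / Im z ^ Suc m" and y0: "0 < y0"
  shows "\<exists>C. \<forall>z. y0 \<le> Im z \<longrightarrow> cmod (F z) \<le> C * cmod (z + \<i>) / Im z powr (3/2)"
proof -
  obtain C where C: "0 < C" "\<And>z w. \<lbrakk>0 < Im z; 0 < Im w\<rbrakk> \<Longrightarrow>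
      omega z powr s \<le> C * omega w powr s * (cmod (z - cnj w) / sqrt (Im z * Im w))"
    using omega_powr_le by blast
  define c where "c = omega \<i> powr s"
  have c: "0 < c" using omega_ge_1[of \<i>] by (simp add: c_def)
  have B: "0 \<le> B"
    using order_trans[OF _ le[of \<i>]] by (simp add: zero_le_mult_iff)
  have "cmod (F z) \<le> (B * C / (c * y0 ^ m)) * cmod (z + \<i>) / Im z powr (3/2)" if z: "y0 \<le> Im z" for z
  proof -
    have z0: "0 < Im z" using y0 z by linarith
    have "c \<le> C * omega z powr s * (cmod (z + \<i>) / sqrt (Im z))"
      using C(2)[of \<i> z] z0 cmod_diff_cnj_commute[of \<i> z] by (simp add: c_def)
    then have "c * cmod (F z) \<le> C * omega z powr s * (cmod (z + \<i>) / sqrt (Im z)) * cmod (F z)"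
      by (intro mult_right_mono) auto
    also have "\<dots> = C * (cmod (z + \<i>) / sqrt (Im z)) * (cmod (F z) * omega z powr s)"
      by (simp add: mult_ac)
    also have "\<dots> \<le> C * (cmod (z + \<i>) / sqrt (Im z)) * (B / Im z ^ Suc m)"
      using C z0 by (intro mult_left_mono le) auto
    also have "\<dots> \<le> C * (cmod (z + \<i>) / sqrt (Im z)) * (B / (Im z * y0 ^ m))"
      using C z0 B y0 z by (intro mult_left_mono divide_left_mono) (auto intro!: power_mono)
    also have "\<dots> = C * B / y0 ^ m * cmod (z + \<i>) / (sqrt (Im z) * Im z)"
      by (simp add: mult_ac)
    also have "sqrt (Im z) * Im z = Im z powr (1/2 + 1)"
      using z0 by (subst powr_add) (simp add: powr_half_sqrt)
    finally have "cmod (F z) \<le> C * B / y0 ^ m * cmod (z + \<i>) / Im z powr (1/2 + 1) / c"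
      by (intro mult_imp_le_div_pos[OF c]) (simp only: mult.commute[of _ c])
    then show ?thesis by (simp add: mult_ac)
  qed
  then show ?thesis by blast
qed

text \<open>For fixed w the quantity Im z / |cnj z - w|^3 is bounded by a multiple of
  \<open>omega z powr s\<close>: bounding \<open>omega w\<close> by \<open>omega z\<close> leaves a
  quotient that is controlled by sqrt (Im z * Im w) <= D and Im w <= D. So the integrand is
  dominated by the density of the norm.\<close>

lemma A1_kernel_integrable:
  assumes f: "f \<in> A1 s" and w: "0 < Im w"
  shows "integrable lborel (\<lambda>z. f z * Im z / (cnj z - w) ^ 3)"
proof -
  obtain C where C: "0 < C" "\<And>z w. \<lbrakk>0 < Im z; 0 < Im w\<rbrakk> \<Longrightarrow>
      omega z powr s \<le> C * omega w powr s * (cmod (z - cnj w) / sqrt (Im z * Im w))"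
    using omega_powr_le by blast
  have fh: "f \<in> holo_uhp" using f by (simp add: A1_iff)
  note [measurable] = holo_uhp_borel[OF fh]
  define c where "c = omega w powr s"
  have c: "0 < c" using omega_ge_1[of w] by (simp add: c_def)
  have "cmod (f z * Im z / (cnj z - w) ^ 3) \<le> C / (c * (Im w)\<^sup>2) * (cmod (f z) * omega z powr s)" for z
  proof (cases "0 < Im z")
    case True
    define D where "D = cmod (w - cnj z)"
    have D: "Im z + Im w \<le> D" using Im_add_le_cmod_diff_cnj[of w z] by (simp add: D_def)
    then have D0: "0 < D" using True w by linarith
    have D': "cmod (cnj z - w) = D" by (simp add: D_def norm_minus_commute)
    have sq: "sqrt (Im z) * sqrt (Im w) \<le> D"
      using arith_geo_mean_sqrt[of "Im z" "Im w"] D True w by (simp add: real_sqrt_mult)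
    have "c * (Im z / D ^ 3) \<le> C * omega z powr s * (D / (sqrt (Im w) * sqrt (Im z))) * (Im z / D ^ 3)"
      using C(2)[OF w True] True D0 by (intro mult_right_mono) (auto simp: c_def D_def real_sqrt_mult)
    also have "\<dots> = C * omega z powr s * (sqrt (Im z) * sqrt (Im w) / (D * (D * Im w)))"
    proof -
      have "D / (b * a) * ((a * a) / D ^ 3) = a * b / (D * (D * (b * b)))" if "0 < a" "0 < b" for a b
        using that D0 by (simp add: field_simps power3_eq_cube)
      from this[of "sqrt (Im z)" "sqrt (Im w)"]
      have "D / (sqrt (Im w) * sqrt (Im z)) * (Im z / D ^ 3) = sqrt (Im z) * sqrt (Im w) / (D * (D * Im w))"
        using True w by simp
      then show ?thesis by (simp only: mult.assoc[of "C * omega z powr s"])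
    qed
    also have "\<dots> \<le> C * omega z powr s * (D / (D * (Im w * Im w)))"
      using C sq D D0 True w by (intro mult_left_mono frac_le mult_mono) auto
    also have "\<dots> = C * omega z powr s / (Im w)\<^sup>2" using D0 by (simp add: power2_eq_square)
    finally have "Im z / D ^ 3 \<le> C * omega z powr s / (Im w)\<^sup>2 / c"
      by (intro mult_imp_le_div_pos[OF c]) (simp only: mult.commute[of _ c])
    then have "cmod (f z) * (Im z / D ^ 3) \<le> cmod (f z) * (C * omega z powr s / (Im w)\<^sup>2 / c)"
      by (rule mult_left_mono) simp
    then show ?thesis
      using True by (simp add: norm_mult norm_divide norm_power D' mult_ac)
  qed (use holo_uhp_outside[OF fh, of z] in simp)
  note le = this
  have [measurable]: "cnj \<in> borel_measurable borel"
    by (intro borel_measurable_continuous_onI continuous_intros)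
  show ?thesis
  proof (rule Bochner_Integration.integrable_bound)
    show "integrable lborel (\<lambda>z. C / (c * (Im w)\<^sup>2) * (cmod (f z) * omega z powr s))"
      using f by (intro integrable_mult_right) (simp add: A1_iff)
    show "(\<lambda>z. f z * Im z / (cnj z - w) ^ 3) \<in> borel_measurable lborel"
      by measurable
    show "AE z in lborel. cmod (f z * Im z / (cnj z - w) ^ 3)
        \<le> norm (C / (c * (Im w)\<^sup>2) * (cmod (f z) * omega z powr s))"
      unfolding real_norm_def using order_trans[OF le abs_ge_self] by blast
  qed
qed

text \<open>Here the integration variable is the parameter of the kernel, so f appears as a
  superposition of elements of \<open>A1 s\<close>; this is the form to which a functional can be
  applied. The odd exponent changes the sign of the constant.\<close>

lemma A1_reproducing:
  assumes f: "f \<in> A1 s" and w: "0 < Im w"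
  shows "f w = - (4 * \<i> / pi) * (LBINT z. f z * Im z * cubic_kernel z w)"
proof -
  have fh: "f \<in> holo_uhp" using f by (simp add: A1_iff)
  obtain B where B: "\<And>z. 0 < Im z \<Longrightarrow> cmod (f z) * omega z powr s \<le> B / Im z ^ Suc 1"
    using A1_pointwise_bound[OF f] by (auto simp: numeral_2_eq_2)
  have ind: "indicator upper_half_plane z *\<^sub>R (f z * Im z / (cnj z - w) ^ 3) = f z * Im z / (cnj z - w) ^ 3" for z
    using holo_uhp_outside[OF fh, of z] by (cases "0 < Im z") (auto simp: uhp_iff)
  have "(LBINT z. f z * Im z / (cnj z - w) ^ 3) = - (pi * \<i> / 4) * f w"
    using reproducing_formula[OF _ w omega_weighted_growth[OF B]] fh A1_kernel_integrable[OF f w]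
    unfolding ind by (simp add: holo_uhp_def)
  moreover have "f z * Im z / (cnj z - w) ^ 3 = - (f z * Im z * cubic_kernel z w)" for z
  proof -
    have "(cnj z - w) ^ 3 = - ((w - cnj z) ^ 3)" by (simp add: power3_eq_cube algebra_simps)
    then show ?thesis using w by (simp add: cubic_kernel_def uhp_iff)
  qed
  ultimately have *: "(LBINT z. f z * Im z * cubic_kernel z w) = pi * \<i> / 4 * f w"
    by simp
  show ?thesis unfolding * by simp
qed

section \<open>The Bloch seminorm and the pairing\<close>

lemma bloch_holo_deriv: "g \<in> bloch k \<Longrightarrow> deriv g holomorphic_on upper_half_plane"
  using holomorphic_deriv open_upper_half_plane by (auto simp: bloch_def holo_uhp_def)

lemma bloch_seminorm_upper:
  assumes "g \<in> bloch k" "0 < Im z"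
  shows "Im z * omega z powr k * cmod (deriv g z) \<le> bloch_seminorm k g"
  unfolding bloch_seminorm_def using assms by (intro cSUP_upper) (auto simp: bloch_def uhp_iff)

lemma bloch_seminorm_nonneg: "g \<in> bloch k \<Longrightarrow> 0 \<le> bloch_seminorm k g"
  by (rule order_trans[OF _ bloch_seminorm_upper[of g k \<i>]]) auto

lemma bloch_seminorm_least:
  assumes "\<And>z. 0 < Im z \<Longrightarrow> Im z * omega z powr k * cmod (deriv g z) \<le> B"
  shows "bloch_seminorm k g \<le> B"
proof -
  have "upper_half_plane \<noteq> {}" using uhp_iff[of \<i>] by auto
  then show ?thesis
    unfolding bloch_seminorm_def using assms by (intro cSUP_least) (auto simp: uhp_iff)
qed

lemma pairing_integrand_eq:
  assumes "f \<in> holo_uhp"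
  shows "indicator upper_half_plane z *\<^sub>R (f z * cnj (deriv g z) * Im z) = f z * cnj (deriv g z) * Im z"
  using holo_uhp_outside[OF assms, of z] by (cases "0 < Im z") (auto simp: uhp_iff)

text \<open>The seminorm bounds |g'| * Im z by a multiple of \<open>omega z powr (- k)\<close>, the
  weight of the norm of f; the pairing is thus estimated like an integral of a product of an L^1 and
  an L^infinity function.\<close>

lemma
  assumes f: "f \<in> A1 (- k)" and g: "g \<in> bloch k"
  shows pairing_integrable: "integrable lborel (\<lambda>z. f z * cnj (deriv g z) * Im z)"
    and norm_pairing_le: "cmod (pairing f g) \<le> bloch_seminorm k g * A1_norm (- k) f"
proof -
  let ?h = "\<lambda>z. f z * cnj (deriv g z) * Im z"
  have fh: "f \<in> holo_uhp" using f by (simp add: A1_iff)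
  note [measurable] = holo_uhp_borel[OF fh] holo_uhp_measurable[OF bloch_holo_deriv[OF g]]
  have le: "cmod (?h z) \<le> bloch_seminorm k g * (cmod (f z) * omega z powr (- k))" for z
  proof (cases "0 < Im z")
    case True
    have o: "0 < omega z" using omega_ge_1[of z] by linarith
    have "cmod (deriv g z) * Im z \<le> bloch_seminorm k g * omega z powr (- k)"
      using bloch_seminorm_upper[OF g True] o by (simp add: powr_minus field_simps)
    then have "cmod (f z) * (cmod (deriv g z) * Im z) \<le> cmod (f z) * (bloch_seminorm k g * omega z powr (- k))"
      by (rule mult_left_mono) simp
    then show ?thesis using True by (simp add: norm_mult mult_ac)
  qed (use holo_uhp_outside[OF fh, of z] in simp)
  have [measurable]: "cnj \<in> borel_measurable borel"
    by (intro borel_measurable_continuous_onI continuous_intros)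
  \<comment> \<open>Nothing is known about \<open>deriv g\<close> off the open half plane. It is cut
    off there, which leaves the product unchanged because f vanishes.\<close>
  have meas: "?h \<in> borel_measurable lborel"
  proof -
    have "(\<lambda>z. f z * cnj (indicator upper_half_plane z *\<^sub>R deriv g z) * Im z) \<in> borel_measurable borel"
      by measurable
    also have "(\<lambda>z. f z * cnj (indicator upper_half_plane z *\<^sub>R deriv g z) * Im z) = ?h"
      using holo_uhp_outside[OF fh] by (intro ext) (auto simp: indicator_def uhp_iff)
    finally show ?thesis by simp
  qed
  have intb: "integrable lborel (\<lambda>z. bloch_seminorm k g * (cmod (f z) * omega z powr (- k)))"
    using f by (intro integrable_mult_right) (simp add: A1_iff)
  show int: "integrable lborel ?h"
    by (rule Bochner_Integration.integrable_bound[OF intb meas])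
      (unfold real_norm_def, use order_trans[OF le abs_ge_self] in blast)
  have "cmod (LBINT z. ?h z) \<le> (LBINT z. bloch_seminorm k g * (cmod (f z) * omega z powr (- k)))"
    by (rule order_trans[OF integral_norm_bound integral_mono[OF integrable_norm[OF int] intb le]])
  then show "cmod (pairing f g) \<le> bloch_seminorm k g * A1_norm (- k) f"
    by (simp add: pairing_def set_lebesgue_integral_def pairing_integrand_eq[OF fh] A1_norm_eq[OF fh])
qed

lemma pairing_eq_integral: "f \<in> holo_uhp \<Longrightarrow> pairing f g = (LBINT z. f z * cnj (deriv g z) * Im z)"
  by (simp add: pairing_def set_lebesgue_integral_def pairing_integrand_eq)

text \<open>Conjugating the integrand of the pairing with the kernel yields the reproducing
  integrand for F = g'; the growth hypothesis is the defining bound of the Bloch space.\<close>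

lemma pairing_cubic_kernel:
  assumes g: "g \<in> bloch k" and w: "0 < Im w"
  shows "cnj (deriv g w) = - (4 * \<i> / pi) * pairing (cubic_kernel w) g"
proof -
  have K: "cubic_kernel w \<in> A1 (- k)"
    using cubic_kernel_A1_norm_le[of "- k"] w by blast
  note Kh = cubic_kernel_in_holo_uhp[OF w]
  have eq: "cnj (cubic_kernel w z * cnj (deriv g z) * Im z)
      = indicator upper_half_plane z *\<^sub>R (deriv g z * Im z / (cnj z - w) ^ 3)" for z
    by (simp add: cubic_kernel_def)
  have B: "cmod (deriv g z) * omega z powr k \<le> bloch_seminorm k g / Im z ^ Suc 0" if "0 < Im z" for z
    using bloch_seminorm_upper[OF g that] that by (simp add: field_simps)
  have "integrable lborel (\<lambda>z. cnj (cubic_kernel w z * cnj (deriv g z) * Im z))"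
    using pairing_integrable[OF K g] by (simp only: integrable_cnj)
  then have "(LBINT z. cnj (cubic_kernel w z * cnj (deriv g z) * Im z)) = - (pi * \<i> / 4) * deriv g w"
    unfolding eq by (intro reproducing_formula[OF bloch_holo_deriv[OF g] w omega_weighted_growth[OF B]])
  then have "cnj (pairing (cubic_kernel w) g) = - (pi * \<i> / 4) * deriv g w"
    unfolding pairing_eq_integral[OF Kh] Bochner_Integration.integral_cnj .
  then have *: "pairing (cubic_kernel w) g = cnj (- (pi * \<i> / 4) * deriv g w)"
    by (metis complex_cnj_cnj)
  show ?thesis unfolding * by simp
qed

subsection \<open>The dual space\<close>

lemma A1_dominated:
  assumes h: "h \<in> holo_uhp" and f: "f \<in> A1 s" and c: "0 \<le> c"
    and le: "\<And>z. cmod (h z) \<le> c * cmod (f z)"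
  shows "h \<in> A1 s" "A1_norm s h \<le> c * A1_norm s f"
proof -
  have fh: "f \<in> holo_uhp" using f by (simp add: A1_iff)
  note [measurable] = holo_uhp_borel[OF fh]
  have "(\<integral>\<^sup>+z. ennreal (cmod (h z) * omega z powr s) \<partial>lborel)
      \<le> (\<integral>\<^sup>+z. ennreal c * ennreal (cmod (f z) * omega z powr s) \<partial>lborel)"
    using mult_right_mono[OF le] c
    by (intro nn_integral_mono) (simp add: ennreal_mult'[symmetric] ennreal_leI mult.assoc[symmetric])
  also have "\<dots> = ennreal (c * A1_norm s f)"
    unfolding ennreal_mult'[OF c] ennreal_A1_norm[OF f] by (rule nn_integral_cmult) measurable
  finally show "h \<in> A1 s" "A1_norm s h \<le> c * A1_norm s f"
    using A1I_nn_integral[OF h] c A1_norm_nonneg[OF f] by auto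
qed

lemma A1_dual_linear:
  "L \<in> A1_dual s \<Longrightarrow> f \<in> A1 s \<Longrightarrow> h \<in> A1 s \<Longrightarrow> L (\<lambda>z. a * f z + b * h z) = a * L f + b * L h"
  by (auto simp: A1_dual_def)

lemma A1_dual_zero: "L \<in> A1_dual s \<Longrightarrow> L (\<lambda>z. 0) = 0"
  using A1_dual_linear[of L s "\<lambda>z. 0" "\<lambda>z. 0" 0 0] A1_zero by simp

text \<open>The supremum is meaningful only once it is known to be bounded, which the constant in
  \<open>A1_dual\<close> provides. The inequality then follows by normalising f, and by the same
  constant if f has norm 0.\<close>

lemma
  assumes L: "L \<in> A1_dual s"
  shows norm_le_A1_dual_norm: "f \<in> A1 s \<Longrightarrow> cmod (L f) \<le> A1_dual_norm s L * A1_norm s f"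
    and A1_dual_norm_nonneg: "0 \<le> A1_dual_norm s L"
proof -
  obtain C where C: "\<And>f. f \<in> A1 s \<Longrightarrow> cmod (L f) \<le> C * A1_norm s f"
    using L unfolding A1_dual_def by blast
  have bdd: "bdd_above ((\<lambda>f. cmod (L f)) ` {f \<in> A1 s. A1_norm s f \<le> 1})"
  proof (rule bdd_aboveI2)
    fix f assume f: "f \<in> {f \<in> A1 s. A1_norm s f \<le> 1}"
    \<comment> \<open>The definition of \<open>A1_dual\<close> leaves the sign of C open, hence the
      absolute value.\<close>
    then have "cmod (L f) \<le> \<bar>C\<bar> * A1_norm s f"
      using order_trans[OF C mult_right_mono[OF abs_ge_self]] A1_norm_nonneg by blast
    also have "\<dots> \<le> \<bar>C\<bar> * 1" using f by (intro mult_left_mono) auto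
    finally show "cmod (L f) \<le> \<bar>C\<bar>" by simp
  qed
  have upper: "cmod (L f) \<le> A1_dual_norm s L" if "f \<in> A1 s" "A1_norm s f \<le> 1" for f
    unfolding A1_dual_norm_def using that by (intro cSUP_upper bdd) auto
  have "A1_norm s (\<lambda>z. 0) = 0" by (simp add: A1_norm_def set_lebesgue_integral_def)
  then show "0 \<le> A1_dual_norm s L"
    using order_trans[OF norm_ge_zero upper[of "\<lambda>z. 0"]] A1_zero by simp
  show "cmod (L f) \<le> A1_dual_norm s L * A1_norm s f" if f: "f \<in> A1 s"
  proof (cases "A1_norm s f = 0")
    case True
    then show ?thesis using C[OF f] by simp
  next
    case False
    define n where "n = A1_norm s f"
    have n: "0 < n" using False A1_norm_nonneg[OF f] by (simp add: n_def)
    \<comment> \<open>The summand with coefficient 0 puts the scaled function into the two-term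
      shape in which linearity is stated.\<close>
    let ?h = "\<lambda>z. complex_of_real (1 / n) * f z + 0 * f z"
    have "A1_norm s ?h \<le> cmod (complex_of_real (1 / n)) * n + cmod 0 * n"
      unfolding n_def by (rule A1_norm_lincomb_le[OF f f])
    then have "A1_norm s ?h \<le> 1" using n by (simp add: norm_divide)
    then have "cmod (L ?h) \<le> A1_dual_norm s L" by (intro upper A1_lincomb f)
    moreover have "L ?h = complex_of_real (1 / n) * L f"
      using A1_dual_linear[OF L f f, of "complex_of_real (1 / n)" 0] by simp
    ultimately have "cmod (L f) / n \<le> A1_dual_norm s L" using n by (simp add: norm_mult norm_divide)
    then show ?thesis using n by (simp add: n_def[symmetric] pos_divide_le_eq)
  qed
qed

lemma A1_dual_norm_least:
  assumes "\<And>f. f \<in> A1 s \<Longrightarrow> cmod (L f) \<le> B * A1_norm s f" and B: "0 \<le> B"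
  shows "A1_dual_norm s L \<le> B"
  unfolding A1_dual_norm_def
proof (rule cSUP_least)
  show "{f \<in> A1 s. A1_norm s f \<le> 1} \<noteq> {}"
    using A1_zero by (auto intro!: exI[of _ "\<lambda>z. 0"] simp: A1_norm_def set_lebesgue_integral_def)
  fix f assume f: "f \<in> {f \<in> A1 s. A1_norm s f \<le> 1}"
  then show "cmod (L f) \<le> B"
    using order_trans[OF assms(1) mult_left_mono[OF _ B]] by fastforce
qed

lemma
  assumes L: "L \<in> A1_dual s" and V: "finite V" and K: "\<And>v. v \<in> V \<Longrightarrow> K v \<in> A1 s"
  shows A1_sum: "(\<lambda>z. \<Sum>v\<in>V. c v * K v z) \<in> A1 s"
    and A1_dual_sum: "L (\<lambda>z. \<Sum>v\<in>V. c v * K v z) = (\<Sum>v\<in>V. c v * L (K v))"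
proof -
  have "(\<lambda>z. \<Sum>v\<in>V. c v * K v z) \<in> A1 s \<and> L (\<lambda>z. \<Sum>v\<in>V. c v * K v z) = (\<Sum>v\<in>V. c v * L (K v))"
    using V K
  proof (induction V rule: finite_induct)
    case empty
    then show ?case by (simp add: A1_zero A1_dual_zero[OF L])
  next
    case (insert v V)
    then have *: "(\<lambda>z. \<Sum>v\<in>V. c v * K v z) \<in> A1 s" "L (\<lambda>z. \<Sum>v\<in>V. c v * K v z) = (\<Sum>v\<in>V. c v * L (K v))"
      "K v \<in> A1 s" by auto
    show ?case
      using A1_lincomb[OF *(3,1), of "c v" 1] A1_dual_linear[OF L *(3,1), of "c v" 1] insert(1,2) *(2)
      by simp
  qed
  then show "(\<lambda>z. \<Sum>v\<in>V. c v * K v z) \<in> A1 s"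
    "L (\<lambda>z. \<Sum>v\<in>V. c v * K v z) = (\<Sum>v\<in>V. c v * L (K v))" by auto
qed

section \<open>Dependence of the kernels on their parameter, in norm\<close>

text \<open>The pointwise relative bound on the difference integrates against any weight. The
  coefficients 1 and -1 are written out so that linearity of a functional applies directly.\<close>

lemma
  assumes w: "0 < Im w" and near: "cmod (v - w) \<le> Im w / 2"
  shows cubic_kernel_diff_A1: "(\<lambda>z. 1 * cubic_kernel v z + (-1) * cubic_kernel w z) \<in> A1 s"
    and A1_norm_cubic_kernel_diff_le: "A1_norm s (\<lambda>z. 1 * cubic_kernel v z + (-1) * cubic_kernel w z)
      \<le> 38 * (cmod (v - w) / Im w) * A1_norm s (cubic_kernel w)"
proof -
  have v: "0 < Im v" using Im_near(1)[OF w near] w by linarith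
  have K: "cubic_kernel w \<in> A1 s" using cubic_kernel_A1_norm_le[of s] w by blast
  have holo: "(\<lambda>z. 1 * cubic_kernel v z + (-1) * cubic_kernel w z) \<in> holo_uhp"
    using v w by (intro holo_uhp_lincomb cubic_kernel_in_holo_uhp)
  show "(\<lambda>z. 1 * cubic_kernel v z + (-1) * cubic_kernel w z) \<in> A1 s"
    "A1_norm s (\<lambda>z. 1 * cubic_kernel v z + (-1) * cubic_kernel w z)
      \<le> 38 * (cmod (v - w) / Im w) * A1_norm s (cubic_kernel w)"
    using A1_dominated[OF holo K, of "38 * (cmod (v - w) / Im w)"] cubic_kernel_lipschitz[OF w near] w
    by auto
qed

lemma norm_A1_dual_cubic_kernel_diff_le:
  assumes L: "L \<in> A1_dual s" and w: "0 < Im w" and near: "cmod (v - w) \<le> Im w / 2"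
  shows "cmod (L (cubic_kernel v) - L (cubic_kernel w))
    \<le> A1_dual_norm s L * (38 * (cmod (v - w) / Im w) * A1_norm s (cubic_kernel w))"
proof -
  have v: "0 < Im v" using Im_near(1)[OF w near] w by linarith
  have K: "cubic_kernel v \<in> A1 s" "cubic_kernel w \<in> A1 s"
    using cubic_kernel_A1_norm_le[of s] v w by blast+
  have "L (\<lambda>z. 1 * cubic_kernel v z + (-1) * cubic_kernel w z) = L (cubic_kernel v) - L (cubic_kernel w)"
    by (subst A1_dual_linear[OF L K]) simp
  then have "cmod (L (cubic_kernel v) - L (cubic_kernel w))
      \<le> A1_dual_norm s L * A1_norm s (\<lambda>z. 1 * cubic_kernel v z + (-1) * cubic_kernel w z)"
    using norm_le_A1_dual_norm[OF L cubic_kernel_diff_A1[OF w near]] by simp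
  also have "\<dots> \<le> A1_dual_norm s L * (38 * (cmod (v - w) / Im w) * A1_norm s (cubic_kernel w))"
    by (intro mult_left_mono A1_norm_cubic_kernel_diff_le[OF w near] A1_dual_norm_nonneg[OF L])
  finally show ?thesis .
qed

text \<open>The derivative of the cubic kernel with respect to \<open>cnj w\<close>.\<close>
definition quartic_kernel :: "complex \<Rightarrow> complex \<Rightarrow> complex" where
  "quartic_kernel w z = (if z \<in> upper_half_plane then 3 / (z - cnj w) ^ 4 else 0)"

text \<open>Since |z - cnj w| >= Im w, the additional power in the denominator costs only a
  constant, and the cubic kernel dominates.\<close>

lemma quartic_kernel_in_A1:
  assumes w: "0 < Im w"
  shows "quartic_kernel w \<in> A1 s"
proof -
  have K: "cubic_kernel w \<in> A1 s" using cubic_kernel_A1_norm_le[of s] w by blast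
  have "(\<lambda>z. 3 / (z - cnj w) ^ 4) holomorphic_on upper_half_plane"
    using w by (intro holomorphic_intros) (auto simp: uhp_iff diff_cnj_neq_0)
  then have "quartic_kernel w holomorphic_on upper_half_plane"
    by (rule holomorphic_transform) (simp add: quartic_kernel_def)
  then have holo: "quartic_kernel w \<in> holo_uhp" by (simp add: holo_uhp_def quartic_kernel_def)
  have "cmod (quartic_kernel w z) \<le> 3 / Im w * cmod (cubic_kernel w z)" for z
  proof (cases "0 < Im z")
    case True
    have D: "Im w \<le> cmod (z - cnj w)" using Im_add_le_cmod_diff_cnj[of z w] True by linarith
    then have D0: "0 < cmod (z - cnj w)" using w by linarith
    have "3 / cmod (z - cnj w) ^ 4 = 3 / cmod (z - cnj w) * (1 / cmod (z - cnj w) ^ 3)"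
      by (simp add: power4_eq_xxxx power3_eq_cube)
    also have "\<dots> \<le> 3 / Im w * (1 / cmod (z - cnj w) ^ 3)"
      using D w mult_pos_pos[OF D0 w] by (intro mult_right_mono divide_left_mono) auto
    finally show ?thesis
      using True by (simp add: quartic_kernel_def cubic_kernel_def uhp_iff norm_divide norm_power)
  qed (use w in \<open>simp add: quartic_kernel_def uhp_iff\<close>)
  then show ?thesis using A1_dominated(1)[OF holo K, of "3 / Im w"] w by auto
qed

text \<open>First-order Taylor formula in \<open>cnj w\<close>, with remainder relative to the
  kernel. For b = a - e the numerator a^4 - a b^3 - 3 e b^3 has the factor e^2, and |e| <= |a| / 2
  bounds the cofactor by (6 + 4 + 3/4) |a|^2 <= 11 |a|^2; 88 is 8 * 11, with 8 from |b| >= |a| /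
  2.\<close>

lemma cubic_kernel_taylor:
  assumes w: "0 < Im w" and near: "cmod (v - w) \<le> Im w / 2"
  shows "cmod (cubic_kernel v z - cubic_kernel w z - cnj (v - w) * quartic_kernel w z)
      \<le> 88 * (cmod (v - w) / Im w)\<^sup>2 * cmod (cubic_kernel w z)"
proof (cases "0 < Im z")
  case True
  define a b e where "a = z - cnj w" and "b = z - cnj v" and "e = cnj (v - w)"
  have v: "0 < Im v" using Im_near(1)[OF w near] w by linarith
  have ab: "b = a - e" by (simp add: a_def b_def e_def)
  have wa: "Im w \<le> cmod a" using Im_add_le_cmod_diff_cnj[of z w] True by (simp add: a_def)
  have nz: "a \<noteq> 0" "b \<noteq> 0"
    using diff_cnj_neq_0[of z w] diff_cnj_neq_0[of z v] True w v by (auto simp: a_def b_def)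
  have ne: "cmod e = cmod (v - w)" by (simp add: e_def del: complex_cnj_diff)
  have d: "cmod e \<le> cmod a / 2" using near wa by (auto simp: ne)
  have b1: "cmod a / 2 \<le> cmod b"
    using norm_triangle_ineq2[of a e] d by (simp add: ab)
  have "1 / b ^ 3 - 1 / a ^ 3 - e * (3 / a ^ 4) = (a ^ 4 - a * b ^ 3 - 3 * e * b ^ 3) / (a ^ 4 * b ^ 3)"
    using nz by (simp add: field_simps power4_eq_xxxx power3_eq_cube)
  also have "a ^ 4 - a * b ^ 3 - 3 * e * b ^ 3 = e\<^sup>2 * (6 * a\<^sup>2 - 8 * (a * e) + 3 * e\<^sup>2)"
    unfolding ab by (simp add: power4_eq_xxxx power3_eq_cube power2_eq_square algebra_simps)
  finally have "cmod (1 / b ^ 3 - 1 / a ^ 3 - e * (3 / a ^ 4))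
      = (cmod e)\<^sup>2 * cmod (6 * a\<^sup>2 - 8 * (a * e) + 3 * e\<^sup>2) / (cmod a ^ 4 * cmod b ^ 3)"
    by (simp add: norm_mult norm_divide norm_power)
  also have "\<dots> \<le> (cmod e)\<^sup>2 * (11 * (cmod a)\<^sup>2) / (cmod a ^ 4 * (cmod a / 2) ^ 3)"
  proof (intro frac_le mult_left_mono mult_nonneg_nonneg)
    have "cmod (6 * a\<^sup>2 - 8 * (a * e) + 3 * e\<^sup>2) \<le> cmod (6 * a\<^sup>2) + cmod (8 * (a * e)) + cmod (3 * e\<^sup>2)"
      by (intro norm_triangle_le norm_triangle_le_diff add_right_mono order_refl)
    also have "\<dots> = 6 * (cmod a)\<^sup>2 + 8 * (cmod a * cmod e) + 3 * (cmod e)\<^sup>2"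
      by (simp add: norm_mult norm_power)
    also have "\<dots> \<le> 6 * (cmod a)\<^sup>2 + 8 * (cmod a * (cmod a / 2)) + 3 * (cmod a / 2)\<^sup>2"
      using d by (intro add_mono mult_left_mono power_mono) auto
    also have "\<dots> \<le> 11 * (cmod a)\<^sup>2" by (simp add: power2_eq_square)
    finally show "cmod (6 * a\<^sup>2 - 8 * (a * e) + 3 * e\<^sup>2) \<le> 11 * (cmod a)\<^sup>2" .
    show "(cmod a / 2) ^ 3 \<le> cmod b ^ 3" using b1 by (intro power_mono) auto
  qed (use nz in auto)
  also have "\<dots> = 88 * (cmod e / cmod a)\<^sup>2 * (1 / cmod a ^ 3)"
    using nz by (simp add: power2_eq_square power3_eq_cube power4_eq_xxxx field_simps)
  also have "\<dots> \<le> 88 * (cmod e / Im w)\<^sup>2 * (1 / cmod a ^ 3)"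
    using wa w nz by (intro mult_right_mono mult_left_mono power_mono divide_left_mono) auto
  finally have main: "cmod (1 / b ^ 3 - 1 / a ^ 3 - e * (3 / a ^ 4))
      \<le> 88 * (cmod e / Im w)\<^sup>2 * (1 / cmod a ^ 3)" .
  have K: "cubic_kernel v z = 1 / b ^ 3" "cubic_kernel w z = 1 / a ^ 3" "quartic_kernel w z = 3 / a ^ 4"
    using True by (simp_all add: cubic_kernel_def quartic_kernel_def uhp_iff a_def b_def)
  show ?thesis
    unfolding K e_def[symmetric] ne[symmetric] using main by (simp add: norm_divide norm_power)
qed (simp add: cubic_kernel_def quartic_kernel_def uhp_iff)

text \<open>The Taylor remainder is quadratically small in the norm of \<open>A1 s\<close>, so L may
  be applied to the expansion; conjugation turns the increment cnj (v - w) into v - w, and the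
  derivative is the conjugate of L at the quartic kernel.\<close>

lemma A1_dual_kernel_holomorphic:
  assumes L: "L \<in> A1_dual s"
  shows "(\<lambda>w. cnj (L (cubic_kernel w))) holomorphic_on upper_half_plane"
proof (rule holomorphic_onI)
  fix w assume "w \<in> upper_half_plane"
  then have w: "0 < Im w" by (simp add: uhp_iff)
  define B where "B = A1_dual_norm s L * (88 * (1 / Im w)\<^sup>2 * A1_norm s (cubic_kernel w))"
  have Kw: "cubic_kernel w \<in> A1 s" using cubic_kernel_A1_norm_le[of s] w by blast
  note M = quartic_kernel_in_A1[OF w, of s]
  have est: "cmod ((cnj (L (cubic_kernel v)) - cnj (L (cubic_kernel w))) / (v - w) - cnj (L (quartic_kernel w)))
      \<le> B * cmod (v - w)" if near: "cmod (v - w) \<le> Im w / 2" and "v \<noteq> w" for v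
  proof -
    have v: "0 < Im v" using Im_near(1)[OF w near] w by linarith
    have Kv: "cubic_kernel v \<in> A1 s" using cubic_kernel_A1_norm_le[of s] v by blast
    let ?d = "\<lambda>z. 1 * cubic_kernel v z + (-1) * cubic_kernel w z"
    let ?r = "\<lambda>z. 1 * ?d z + (- cnj (v - w)) * quartic_kernel w z"
    have dA: "?d \<in> A1 s" by (rule cubic_kernel_diff_A1[OF w near])
    have rA: "?r \<in> A1 s" by (rule A1_lincomb[OF dA M])
    have Lr: "L ?r = L (cubic_kernel v) - L (cubic_kernel w) - cnj (v - w) * L (quartic_kernel w)"
      by (subst A1_dual_linear[OF L dA M], subst A1_dual_linear[OF L Kv Kw]) (simp add: algebra_simps)
    have "A1_norm s ?r \<le> 88 * (cmod (v - w) / Im w)\<^sup>2 * A1_norm s (cubic_kernel w)"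
    proof (rule A1_dominated(2)[OF _ Kw])
      show "?r \<in> holo_uhp" using rA by (simp only: A1_iff)
      have "?r z = cubic_kernel v z - cubic_kernel w z - cnj (v - w) * quartic_kernel w z" for z
        by (simp add: algebra_simps)
      then show "cmod (?r z) \<le> 88 * (cmod (v - w) / Im w)\<^sup>2 * cmod (cubic_kernel w z)" for z
        using cubic_kernel_taylor[OF w near, of z] by (simp only:)
    qed simp
    then have "cmod (L ?r) \<le> A1_dual_norm s L * (88 * (cmod (v - w) / Im w)\<^sup>2 * A1_norm s (cubic_kernel w))"
      using order_trans[OF norm_le_A1_dual_norm[OF L rA] mult_left_mono[OF _ A1_dual_norm_nonneg[OF L]]] by blast
    also have "\<dots> = B * (cmod (v - w))\<^sup>2" by (simp add: B_def power_divide)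
    finally have 1: "cmod (L ?r) \<le> B * (cmod (v - w))\<^sup>2" .
    have "(cnj (L (cubic_kernel v)) - cnj (L (cubic_kernel w))) / (v - w) - cnj (L (quartic_kernel w)) = cnj (L ?r) / (v - w)"
      unfolding Lr using that(2) by (simp add: field_simps)
    then have "cmod ((cnj (L (cubic_kernel v)) - cnj (L (cubic_kernel w))) / (v - w) - cnj (L (quartic_kernel w)))
        = cmod (L ?r) / cmod (v - w)"
      by (simp only: norm_divide complex_mod_cnj)
    also have "\<dots> \<le> B * cmod (v - w)"
      using 1 that(2) by (simp add: pos_divide_le_eq power2_eq_square mult.assoc)
    finally show ?thesis .
  qed
  have "((\<lambda>w. cnj (L (cubic_kernel w))) has_field_derivative cnj (L (quartic_kernel w))) (at w)"
    unfolding has_field_derivative_iff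
  proof (rule Lim_null[THEN iffD2], rule Lim_null_comparison)
    have "\<forall>\<^sub>F v in at w. dist v w < Im w / 2 \<and> v \<noteq> w"
      using w by (auto simp: eventually_at intro!: exI[of _ "Im w / 2"])
    then show "\<forall>\<^sub>F v in at w. cmod ((cnj (L (cubic_kernel v)) - cnj (L (cubic_kernel w))) / (v - w)
        - cnj (L (quartic_kernel w))) \<le> B * cmod (v - w)"
      by eventually_elim (rule est; simp add: dist_norm)
    have "((\<lambda>v. B * cmod (v - w)) \<longlongrightarrow> B * cmod (w - w)) (at w)"
      by (intro tendsto_intros)
    then show "((\<lambda>v. B * cmod (v - w)) \<longlongrightarrow> 0) (at w)" by simp
  qed
  then show "(\<lambda>w. cnj (L (cubic_kernel w))) field_differentiable at w within upper_half_plane"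
    by (meson field_differentiable_at_within field_differentiable_def)
qed

text \<open>Near w the ratio in the comparison of weights is at most 5: the numerator is at most
  (1/2 + 2) * Im w and the denominator at least Im w / 2. The ratio is symmetric in v and w, so both
  inequalities follow.\<close>

lemma omega_powr_near:
  fixes s :: real
  obtains C where "0 < C" and
    "\<And>v w. \<lbrakk>0 < Im w; cmod (v - w) \<le> Im w / 2\<rbrakk> \<Longrightarrow>
      omega v powr s \<le> C * omega w powr s \<and> omega w powr s \<le> C * omega v powr s"
proof -
  obtain C where C: "0 < C" "\<And>z w. \<lbrakk>0 < Im z; 0 < Im w\<rbrakk> \<Longrightarrow>
      omega z powr s \<le> C * omega w powr s * (cmod (z - cnj w) / sqrt (Im z * Im w))"
    using omega_powr_le by blast
  have "omega v powr s \<le> (5 * C) * omega w powr s \<and> omega w powr s \<le> (5 * C) * omega v powr s"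
    if w: "0 < Im w" and near: "cmod (v - w) \<le> Im w / 2" for v w
  proof -
    have v: "Im w / 2 \<le> Im v" by (rule Im_near(1)[OF w near])
    have v0: "0 < Im v" using v w by linarith
    have "cmod (v - cnj w) \<le> cmod (v - w) + cmod (w - cnj w)"
      using norm_triangle_ineq[of "v - w" "w - cnj w"] by simp
    also have "\<dots> \<le> 5 / 2 * Im w"
      using near w by (simp add: complex_diff_cnj norm_mult)
    finally have 1: "cmod (v - cnj w) \<le> 5 / 2 * Im w" .
    have 2: "Im w / 2 \<le> sqrt (Im v * Im w)"
    proof (rule real_le_rsqrt)
      have "(Im w / 2)\<^sup>2 \<le> Im w / 2 * Im w" using w by (simp add: power2_eq_square)
      also have "\<dots> \<le> Im v * Im w" using v w by (intro mult_right_mono) auto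
      finally show "(Im w / 2)\<^sup>2 \<le> Im v * Im w" .
    qed
    have ratio: "cmod (v - cnj w) / sqrt (Im v * Im w) \<le> 5"
    proof -
      have "cmod (v - cnj w) / sqrt (Im v * Im w) \<le> (5 / 2 * Im w) / (Im w / 2)"
        using 1 2 w by (intro frac_le) auto
      then show ?thesis using w by simp
    qed
    have "omega v powr s \<le> C * omega w powr s * 5"
      using order_trans[OF C(2)[OF v0 w] mult_left_mono[OF ratio]] C(1) by simp
    moreover have "omega w powr s \<le> C * omega v powr s * 5"
      using order_trans[OF C(2)[OF w v0] mult_left_mono[OF ratio[folded cmod_diff_cnj_commute[of w v] mult.commute[of "Im w"]]]] C(1) by simp
    ultimately show ?thesis by (simp add: mult_ac)
  qed
  then show thesis using C(1) by (intro that[of "5 * C"]) auto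
qed

lemma A1_cubic_kernel_integrable:
  assumes f: "f \<in> A1 s" and z: "0 < Im z"
  shows "integrable lborel (\<lambda>w. f w * Im w * cubic_kernel w z)"
proof -
  have "f w * Im w * cubic_kernel w z = - (f w * Im w / (cnj w - z) ^ 3)" for w
  proof -
    have "(cnj w - z) ^ 3 = - ((z - cnj w) ^ 3)" by (simp add: power3_eq_cube algebra_simps)
    then show ?thesis using z by (simp add: cubic_kernel_def uhp_iff)
  qed
  then show ?thesis using A1_kernel_integrable[OF f z] by simp
qed

text \<open>Replacing \<open>w\<close> by simple functions \<open>\<pi> n w\<close> tending to \<open>w\<close> turns the reproducing integral
  into finite linear combinations of kernels, which converge to \<open>f\<close> in norm; so \<open>L\<close> may be
  applied under the integral sign.\<close>
theorem A1_dual_representation: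
  assumes f: "f \<in> A1 s" and L: "L \<in> A1_dual s"
  shows "L f = - (4 * \<i> / pi) * (LBINT w. f w * Im w * L (cubic_kernel w))"
proof -
  define \<kappa> :: complex where "\<kappa> = - (4 * \<i> / pi)"
  define N where "N = A1_dual_norm s L"
  have N: "0 \<le> N" unfolding N_def by (rule A1_dual_norm_nonneg[OF L])
  obtain C0 where C0: "0 < C0" "\<And>w. 0 < Im w \<Longrightarrow> cubic_kernel w \<in> A1 s"
    "\<And>w. 0 < Im w \<Longrightarrow> A1_norm s (cubic_kernel w) \<le> C0 * omega w powr s / Im w"
    using cubic_kernel_A1_norm_le by blast
  obtain C1 where C1: "0 < C1" "\<And>v w. \<lbrakk>0 < Im w; cmod (v - w) \<le> Im w / 2\<rbrakk> \<Longrightarrow>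
      omega v powr s \<le> C1 * omega w powr s \<and> omega w powr s \<le> C1 * omega v powr s"
    using omega_powr_near by blast
  have fh: "f \<in> holo_uhp" and If: "integrable lborel (\<lambda>w. cmod (f w) * omega w powr s)"
    using f by (simp_all add: A1_iff)
  note [measurable] = holo_uhp_borel[OF fh]
  have [measurable]: "cnj \<in> borel_measurable borel"
    by (intro borel_measurable_continuous_onI continuous_intros)
  define q where "q w = f w * complex_of_real (Im w)" for w
  have [measurable]: "q \<in> borel_measurable borel" unfolding q_def by measurable
  have q0: "q w = 0" if "\<not> 0 < Im w" for w using holo_uhp_outside[OF fh that] by (simp add: q_def)
  have nq: "cmod (q w) = cmod (f w) * Im w" if "0 < Im w" for w
    using that by (simp add: q_def norm_mult)
  have "(\<lambda>x. x) \<in> borel_measurable (lborel :: complex measure)" by simp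
  \<comment> \<open>The identity map is the function being approximated; each \<pi> n takes finitely
    many values, so only finitely many kernels occur at stage n.\<close>
  from borel_measurable_implies_sequence_metric[OF this, of 0] obtain \<pi> :: "nat \<Rightarrow> complex \<Rightarrow> complex"
    where \<pi>: "\<And>n. simple_function lborel (\<pi> n)" "\<And>w. (\<lambda>n. \<pi> n w) \<longlonglongrightarrow> w"
    by auto
  have [measurable]: "\<pi> n \<in> borel_measurable borel" for n
    using borel_measurable_simple_function[OF \<pi>(1)[of n]] by simp
  \<comment> \<open>On \<open>E n\<close> the nearby-parameter estimates apply to \<pi> n w and w;
    elsewhere the approximant is set to 0. Every point of the half plane lies in \<open>E n\<close>
    for all large n.\<close>
  define E where "E n = {w. 0 < Im w \<and> cmod (\<pi> n w - w) \<le> Im w / 2}" for n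
  have [measurable]: "E n \<in> sets borel" for n
  proof -
    have "{w \<in> space borel. 0 < Im w \<and> cmod (\<pi> n w - w) \<le> Im w / 2} \<in> sets borel"
      by measurable
    then show ?thesis by (simp add: E_def)
  qed
  have ED: "0 < Im w" "cmod (\<pi> n w - w) \<le> Im w / 2" "0 < Im (\<pi> n w)" "Im w / 2 \<le> Im (\<pi> n w)"
      "Im (\<pi> n w) \<le> 3 / 2 * Im w" if "w \<in> E n" for n w
    using that Im_near[of w "\<pi> n w"] by (auto simp: E_def)
  have ev: "\<forall>\<^sub>F n in sequentially. w \<in> E n" if w: "0 < Im w" for w
  proof -
    have "\<forall>\<^sub>F n in sequentially. dist (\<pi> n w) w < Im w / 2"
      by (rule tendstoD[OF \<pi>(2)]) (use w in simp)
    then show ?thesis by eventually_elim (use w in \<open>auto simp: E_def dist_norm\<close>)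
  qed
  have dist0: "(\<lambda>n. cmod (\<pi> n w - w)) \<longlonglongrightarrow> 0" for w
    using \<pi>(2)[of w] by (simp add: LIM_zero_iff tendsto_norm_zero)
  define V where "V n = {v \<in> range (\<pi> n). 0 < Im v}" for n
  have finV: "finite (V n)" for n
    using simple_functionD(1)[OF \<pi>(1)[of n]] by (simp add: V_def)
  define S where "S n v = {w \<in> E n. \<pi> n w = v}" for n v
  have [measurable]: "S n v \<in> sets borel" for n v
  proof -
    have "E n \<inter> {w \<in> space borel. \<pi> n w = v} \<in> sets borel" by measurable
    then show ?thesis by (simp add: S_def Int_def)
  qed
  define c where "c n v = (LBINT w. indicator (S n v) w * q w)" for n v
  \<comment> \<open>Only f times the weight is known to be integrable, not q. On one level set,
    however, \<open>Im w\<close> and \<open>omega w\<close> are comparable with their values at v,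
    so q is dominated by a constant times f times the weight.\<close>
  have int_piece: "integrable lborel (\<lambda>w. indicator (S n v) w * q w)" if v: "v \<in> V n" for n v
  proof (rule Bochner_Integration.integrable_bound)
    define B where "B = 2 * Im v * C1 / omega v powr s"
    show "integrable lborel (\<lambda>w. B * (cmod (f w) * omega w powr s))"
      by (rule integrable_mult_right[OF If])
    show "(\<lambda>w. indicator (S n v) w * q w) \<in> borel_measurable lborel" by simp
    have ov: "0 < omega v powr s" using omega_ge_1[of v] by simp
    have v0: "0 < Im v" using v by (simp add: V_def)
    have "cmod (indicator (S n v) w * q w) \<le> B * (cmod (f w) * omega w powr s)" for w
    proof (cases "w \<in> S n v")
      case True
      then have w: "w \<in> E n" "\<pi> n w = v" by (auto simp: S_def)
      have "omega v powr s * Im w \<le> (C1 * omega w powr s) * (2 * Im v)"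
        using C1(2)[OF ED(1,2)[OF w(1)]] ED[OF w(1)] C1(1) by (intro mult_mono) (auto simp: w(2))
      then have "Im w \<le> B * omega w powr s"
        using ov by (simp add: B_def field_simps)
      then have "cmod (f w) * Im w \<le> cmod (f w) * (B * omega w powr s)"
        by (rule mult_left_mono) simp
      then show ?thesis using True nq[OF ED(1)[OF w(1)]] by (simp add: mult_ac)
    qed (use C1(1) v0 in \<open>simp add: B_def\<close>)
    then show "AE w in lborel. cmod (indicator (S n v) w * q w) \<le> norm (B * (cmod (f w) * omega w powr s))"
      unfolding real_norm_def using order_trans[OF _ abs_ge_self] by blast
  qed
  \<comment> \<open>The function \<phi> is kept general for two uses: the kernel at a fixed z gives
    the approximant \<open>F n\<close>, and L of the kernel gives L (F n).\<close>
  have pieces: "q w * (if w \<in> E n then \<phi> (\<pi> n w) else 0) = (\<Sum>v\<in>V n. indicator (S n v) w * q w * \<phi> v)"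
    for n w and \<phi> :: "complex \<Rightarrow> complex"
  proof (cases "w \<in> E n")
    case True
    then have "\<pi> n w \<in> V n" using ED(3) by (simp add: V_def)
    moreover have "indicator (S n v) w * q w * \<phi> v = (if \<pi> n w = v then q w * \<phi> v else 0)" for v
      using True by (simp add: S_def)
    ultimately show ?thesis using True finV[of n] by (simp add: sum.delta)
  qed (simp add: S_def)
  have int_pieces: "integrable lborel (\<lambda>w. q w * (if w \<in> E n then \<phi> (\<pi> n w) else 0))"
    for n and \<phi> :: "complex \<Rightarrow> complex"
    unfolding pieces by (intro Bochner_Integration.integrable_sum integrable_mult_left int_piece)
  have LBINT_pieces: "(LBINT w. q w * (if w \<in> E n then \<phi> (\<pi> n w) else 0)) = (\<Sum>v\<in>V n. c n v * \<phi> v)"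
    for n and \<phi> :: "complex \<Rightarrow> complex"
  proof -
    have "(LBINT w. \<Sum>v\<in>V n. indicator (S n v) w * q w * \<phi> v)
        = (\<Sum>v\<in>V n. LBINT w. indicator (S n v) w * q w * \<phi> v)"
      by (intro Bochner_Integration.integral_sum integrable_mult_left int_piece)
    then show ?thesis unfolding pieces by (simp add: c_def)
  qed
  define F where "F n z = (\<Sum>v\<in>V n. (\<kappa> * c n v) * cubic_kernel v z)" for n z
  have KV: "cubic_kernel v \<in> A1 s" if "v \<in> V n" for n v using C0(2) that by (simp add: V_def)
  have FA: "F n \<in> A1 s" for n
    unfolding F_def[abs_def] by (rule A1_sum[OF L finV KV])
  have Feq: "F n z = \<kappa> * (LBINT w. q w * (if w \<in> E n then cubic_kernel (\<pi> n w) z else 0))" for n z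
    unfolding LBINT_pieces[of n "\<lambda>v. cubic_kernel v z"] by (simp add: F_def sum_distrib_left mult.assoc)
  have LF: "L (F n) = \<kappa> * (LBINT w. q w * (if w \<in> E n then L (cubic_kernel (\<pi> n w)) else 0))" for n
    unfolding LBINT_pieces[of n "\<lambda>v. L (cubic_kernel v)"] F_def[abs_def]
    by (subst A1_dual_sum[OF L finV KV]) (auto simp: sum_distrib_left mult.assoc)

  have lim_point: "(\<lambda>n. q w * (if w \<in> E n then L (cubic_kernel (\<pi> n w)) else 0)) \<longlonglongrightarrow> q w * L (cubic_kernel w)" for w
  proof (cases "0 < Im w")
    case True
    have "(\<lambda>n. if w \<in> E n then L (cubic_kernel (\<pi> n w)) else 0) \<longlonglongrightarrow> L (cubic_kernel w)"
    proof (rule Lim_null[THEN iffD2], rule Lim_null_comparison)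
      show "\<forall>\<^sub>F n in sequentially. norm ((if w \<in> E n then L (cubic_kernel (\<pi> n w)) else 0) - L (cubic_kernel w))
          \<le> N * (38 * (cmod (\<pi> n w - w) / Im w) * A1_norm s (cubic_kernel w))"
        using ev[OF True]
        by eventually_elim (use norm_A1_dual_cubic_kernel_diff_le[OF L True] in \<open>auto simp: N_def E_def\<close>)
      show "(\<lambda>n. N * (38 * (cmod (\<pi> n w - w) / Im w) * A1_norm s (cubic_kernel w))) \<longlonglongrightarrow> 0"
        using tendsto_mult_left[OF dist0[of w], of "N * (38 / Im w * A1_norm s (cubic_kernel w))"] by (simp add: mult_ac)
    qed
    then show ?thesis by (rule tendsto_mult_left)
  qed (simp add: q0)
  have lim1: "(\<lambda>n. LBINT w. q w * (if w \<in> E n then L (cubic_kernel (\<pi> n w)) else 0))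
      \<longlonglongrightarrow> (LBINT w. q w * L (cubic_kernel w))"
  proof (rule integral_dominated_convergence)
    have meas: "(\<lambda>w. q w * (if w \<in> E n then L (cubic_kernel (\<pi> n w)) else 0)) \<in> borel_measurable lborel" for n
      using int_pieces[of n "\<lambda>v. L (cubic_kernel v)"] by (rule borel_measurable_integrable)
    then show "(\<lambda>w. q w * (if w \<in> E n then L (cubic_kernel (\<pi> n w)) else 0)) \<in> borel_measurable lborel" for n .
    show "(\<lambda>w. q w * L (cubic_kernel w)) \<in> borel_measurable lborel"
      by (rule borel_measurable_LIMSEQ_metric[OF meas lim_point])
    \<comment> \<open>The kernel norm at \<pi> n w is of order \<open>omega w powr s / Im w\<close>;
      the factor \<open>Im w\<close> in q cancels the denominator, and 2 comes from Im (\<pi> n w)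
      >= Im w / 2.\<close>
    show "integrable lborel (\<lambda>w. (2 * N * C0 * C1) * (cmod (f w) * omega w powr s))"
      by (rule integrable_mult_right[OF If])
    show "AE w in lborel. (\<lambda>n. q w * (if w \<in> E n then L (cubic_kernel (\<pi> n w)) else 0)) \<longlonglongrightarrow> q w * L (cubic_kernel w)"
      using lim_point by simp
    have "cmod (q w * (if w \<in> E n then L (cubic_kernel (\<pi> n w)) else 0))
        \<le> (2 * N * C0 * C1) * (cmod (f w) * omega w powr s)" for n w
    proof (cases "w \<in> E n")
      case True
      note e = ED[OF True]
      have "cmod (L (cubic_kernel (\<pi> n w))) \<le> N * A1_norm s (cubic_kernel (\<pi> n w))"
        unfolding N_def by (rule norm_le_A1_dual_norm[OF L C0(2)[OF e(3)]])
      also have "\<dots> \<le> N * (C0 * omega (\<pi> n w) powr s / Im (\<pi> n w))"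
        by (rule mult_left_mono[OF C0(3)[OF e(3)] N])
      also have "\<dots> \<le> N * (C0 * (C1 * omega w powr s) / (Im w / 2))"
        using C1(2)[OF e(1,2)] C0(1) C1(1) e N by (intro mult_left_mono frac_le) auto
      also have "\<dots> = 2 * N * C0 * C1 * omega w powr s / Im w" by simp
      finally have "cmod (q w) * cmod (L (cubic_kernel (\<pi> n w))) \<le> cmod (q w) * (2 * N * C0 * C1 * omega w powr s / Im w)"
        by (rule mult_left_mono) simp
      also have "\<dots> = (2 * N * C0 * C1) * (cmod (f w) * omega w powr s)"
        using e(1) by (simp add: nq)
      finally show ?thesis using True by (simp add: norm_mult)
    qed (use N C0(1) C1(1) in simp)
    then show "AE w in lborel. cmod (q w * (if w \<in> E n then L (cubic_kernel (\<pi> n w)) else 0))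
        \<le> (2 * N * C0 * C1) * (cmod (f w) * omega w powr s)" for n
      by simp
  qed

  \<comment> \<open>The relative error of the kernel at w: the Lipschitz bound on
    \<open>E n\<close>, and 1 elsewhere, where the whole kernel has been dropped. The bound 19 is 38
    * 1/2.\<close>
  define \<epsilon> where "\<epsilon> n w = (if w \<in> E n then 38 * (cmod (\<pi> n w - w) / Im w) else 1)" for n w
  have [measurable]: "\<epsilon> n \<in> borel_measurable borel" for n unfolding \<epsilon>_def by measurable
  have eps: "0 \<le> \<epsilon> n w" "\<epsilon> n w \<le> 19" for n w
  proof -
    show "0 \<le> \<epsilon> n w" using ED(1)[of w n] by (auto simp: \<epsilon>_def)
    show "\<epsilon> n w \<le> 19" using ED(1,2)[of w n] by (auto simp: \<epsilon>_def field_simps)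
  qed
  define I where "I n = (LBINT w. cmod (f w) * omega w powr s * \<epsilon> n w)" for n
  have Iint: "integrable lborel (\<lambda>w. cmod (f w) * omega w powr s * \<epsilon> n w)" for n
  proof (rule Bochner_Integration.integrable_bound[OF integrable_mult_right[OF If, of 19]])
    have "norm (cmod (f w) * omega w powr s * \<epsilon> n w) \<le> norm (19 * (cmod (f w) * omega w powr s))" for w
      using mult_left_mono[OF eps(2)[of n w], of "cmod (f w) * omega w powr s"] eps(1)[of n w]
      by (simp add: abs_mult mult_ac)
    then show "AE w in lborel. norm (cmod (f w) * omega w powr s * \<epsilon> n w) \<le> norm (19 * (cmod (f w) * omega w powr s))"
      by simp
  qed simp
  have lim2: "I \<longlonglongrightarrow> 0"
  proof -
    have "(\<lambda>n. LBINT w. cmod (f w) * omega w powr s * \<epsilon> n w) \<longlonglongrightarrow> integral\<^sup>L lborel (\<lambda>w :: complex. 0 :: real)"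
    proof (rule integral_dominated_convergence)
      show "integrable lborel (\<lambda>w. 19 * (cmod (f w) * omega w powr s))"
        by (rule integrable_mult_right[OF If])
      have "(\<lambda>n. cmod (f w) * omega w powr s * \<epsilon> n w) \<longlonglongrightarrow> 0" for w
      proof (cases "0 < Im w")
        case True
        have "(\<lambda>n. cmod (f w) * omega w powr s * (38 * (cmod (\<pi> n w - w) / Im w))) \<longlonglongrightarrow> 0"
          using tendsto_mult_left[OF dist0[of w], of "cmod (f w) * omega w powr s * (38 / Im w)"] by (simp add: mult_ac)
        moreover have "\<forall>\<^sub>F n in sequentially. cmod (f w) * omega w powr s * (38 * (cmod (\<pi> n w - w) / Im w))
            = cmod (f w) * omega w powr s * \<epsilon> n w"
          using ev[OF True] by eventually_elim (simp add: \<epsilon>_def)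
        ultimately show ?thesis by (rule Lim_transform_eventually)
      qed (simp add: holo_uhp_outside[OF fh])
      then show "AE w in lborel. (\<lambda>n. cmod (f w) * omega w powr s * \<epsilon> n w) \<longlonglongrightarrow> 0" by simp
      have "norm (cmod (f w) * omega w powr s * \<epsilon> n w) \<le> 19 * (cmod (f w) * omega w powr s)" for n w
        using mult_left_mono[OF eps(2)[of n w], of "cmod (f w) * omega w powr s"] eps(1)[of n w]
        by (simp add: abs_mult mult_ac)
      then show "AE w in lborel. norm (cmod (f w) * omega w powr s * \<epsilon> n w) \<le> 19 * (cmod (f w) * omega w powr s)" for n
        by simp
    qed simp_all
    then show ?thesis by (simp add: I_def[abs_def])
  qed

  define K where "K n w z = cubic_kernel w z - (if w \<in> E n then cubic_kernel (\<pi> n w) z else 0)" for n w z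
  have [measurable]: "(\<lambda>(w, z). K n w z) \<in> borel_measurable (borel \<Otimes>\<^sub>M borel)" for n
    unfolding K_def cubic_kernel_def split_beta' by measurable
  define d where "d n = (\<lambda>z. 1 * f z + (-1) * F n z)" for n
  have dA: "d n \<in> A1 s" for n unfolding d_def by (rule A1_lincomb[OF f FA])
  \<comment> \<open>Reproducing f at z and subtracting \<open>F n\<close> leaves one integral
    against the error kernel \<open>K n w z\<close>; the modulus is taken inside in preparation for
    Tonelli.\<close>
  have d_le: "ennreal (cmod (d n z) * omega z powr s)
      \<le> (\<integral>\<^sup>+w. ennreal (4 / pi * cmod (q w) * (cmod (K n w z) * omega z powr s)) \<partial>lborel)" for n z
  proof (cases "0 < Im z")
    case True
    have i1: "integrable lborel (\<lambda>w. q w * cubic_kernel w z)"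
      unfolding q_def by (rule A1_cubic_kernel_integrable[OF f True])
    note i2 = int_pieces[of n "\<lambda>v. cubic_kernel v z"]
    have "d n z = \<kappa> * (LBINT w. q w * cubic_kernel w z) - \<kappa> * (LBINT w. q w * (if w \<in> E n then cubic_kernel (\<pi> n w) z else 0))"
      using A1_reproducing[OF f True] by (simp add: d_def Feq \<kappa>_def q_def)
    also have "\<dots> = \<kappa> * (LBINT w. q w * K n w z)"
      unfolding right_diff_distrib[symmetric] Bochner_Integration.integral_diff[OF i1 i2, symmetric]
      by (simp add: K_def right_diff_distrib)
    finally have d: "d n z * omega z powr s = (LBINT w. \<kappa> * omega z powr s * (q w * K n w z))"
      by simp
    have "cmod (d n z) * omega z powr s = cmod (d n z * omega z powr s)"
      by (simp add: norm_mult)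
    then have "ennreal (cmod (d n z) * omega z powr s) = ennreal (cmod (LBINT w. \<kappa> * omega z powr s * (q w * K n w z)))"
      using d by simp
    also have "\<dots> \<le> (\<integral>\<^sup>+w. ennreal (cmod (\<kappa> * omega z powr s * (q w * K n w z))) \<partial>lborel)"
    proof (rule integral_norm_bound_ennreal)
      have "integrable lborel (\<lambda>w. q w * K n w z)"
        using Bochner_Integration.integrable_diff[OF i1 i2] by (simp add: K_def right_diff_distrib)
      then show "integrable lborel (\<lambda>w. \<kappa> * omega z powr s * (q w * K n w z))"
        by (rule integrable_mult_right)
    qed
    also have "\<dots> = (\<integral>\<^sup>+w. ennreal (4 / pi * cmod (q w) * (cmod (K n w z) * omega z powr s)) \<partial>lborel)"
      by (intro nn_integral_cong) (simp add: \<kappa>_def norm_mult norm_divide mult_ac)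
    finally show ?thesis .
  next
    case False
    then have "d n z = 0"
      using dA[of n] by (simp add: A1_iff holo_uhp_outside)
    then show ?thesis by simp
  qed
  \<comment> \<open>After the exchange of integrals the z-integral is the \<open>A1\<close> norm of
    a kernel difference, at most \<epsilon> n w times the kernel norm; \<open>Im w\<close> cancels
    again and the density of the norm of f appears.\<close>
  have inner: "(\<integral>\<^sup>+z. ennreal (4 / pi * cmod (q w) * (cmod (K n w z) * omega z powr s)) \<partial>lborel)
      \<le> ennreal (4 / pi * C0 * (cmod (f w) * omega w powr s * \<epsilon> n w))" for n w
  proof (cases "0 < Im w")
    case True
    have "\<exists>h\<in>A1 s. (\<forall>z. cmod (K n w z) = cmod (h z)) \<and> A1_norm s h \<le> \<epsilon> n w * (C0 * omega w powr s / Im w)"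
    proof (cases "w \<in> E n")
      case in_E: True
      let ?h = "\<lambda>z. 1 * cubic_kernel (\<pi> n w) z + (-1) * cubic_kernel w z"
      have "A1_norm s ?h \<le> \<epsilon> n w * A1_norm s (cubic_kernel w)"
        using A1_norm_cubic_kernel_diff_le[OF ED(1,2)[OF in_E]] in_E by (simp add: \<epsilon>_def)
      also have "\<dots> \<le> \<epsilon> n w * (C0 * omega w powr s / Im w)"
        by (rule mult_left_mono[OF C0(3)[OF True] eps(1)])
      finally have 1: "A1_norm s ?h \<le> \<epsilon> n w * (C0 * omega w powr s / Im w)" .
      have 2: "\<forall>z. cmod (K n w z) = cmod (?h z)"
        using in_E by (simp add: K_def norm_minus_commute)
      show ?thesis by (intro bexI[of _ ?h] conjI 1 2 cubic_kernel_diff_A1[OF ED(1,2)[OF in_E]])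
    next
      case False
      then show ?thesis
        using C0(2,3)[OF True] by (intro bexI[of _ "cubic_kernel w"]) (auto simp: K_def \<epsilon>_def)
    qed
    then obtain h where h: "h \<in> A1 s" "\<And>z. cmod (K n w z) = cmod (h z)"
      "A1_norm s h \<le> \<epsilon> n w * (C0 * omega w powr s / Im w)" by blast
    have [measurable]: "h \<in> borel_measurable borel" using h(1) holo_uhp_borel by (simp add: A1_iff)
    have c: "0 \<le> 4 / pi * cmod (q w)" by simp
    have "(\<integral>\<^sup>+z. ennreal (4 / pi * cmod (q w) * (cmod (K n w z) * omega z powr s)) \<partial>lborel)
        = ennreal (4 / pi * cmod (q w)) * ennreal (A1_norm s h)"
      unfolding h(2) ennreal_A1_norm[OF h(1)] ennreal_mult'[OF c] by (rule nn_integral_cmult) measurable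
    also have "\<dots> = ennreal (4 / pi * cmod (q w) * A1_norm s h)"
      by (rule ennreal_mult'[symmetric]) simp
    also have "\<dots> \<le> ennreal (4 / pi * cmod (q w) * (\<epsilon> n w * (C0 * omega w powr s / Im w)))"
      by (intro ennreal_leI mult_left_mono h(3)) simp
    also have "4 / pi * cmod (q w) * (\<epsilon> n w * (C0 * omega w powr s / Im w))
        = 4 / pi * C0 * (cmod (f w) * omega w powr s * \<epsilon> n w)"
      using True by (simp add: nq)
    finally show ?thesis .
  qed (simp add: q0)
  have norm_d: "A1_norm s (d n) \<le> 4 / pi * C0 * I n" for n
  proof -
    have I0: "0 \<le> I n" unfolding I_def using eps(1) by (intro integral_nonneg_AE) simp
    have "(\<integral>\<^sup>+z. ennreal (cmod (d n z) * omega z powr s) \<partial>lborel)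
        \<le> (\<integral>\<^sup>+z. \<integral>\<^sup>+w. ennreal (4 / pi * cmod (q w) * (cmod (K n w z) * omega z powr s)) \<partial>lborel \<partial>lborel)"
      by (intro nn_integral_mono d_le)
    also have "\<dots> = (\<integral>\<^sup>+w. \<integral>\<^sup>+z. ennreal (4 / pi * cmod (q w) * (cmod (K n w z) * omega z powr s)) \<partial>lborel \<partial>lborel)"
      by (rule lborel_pair.Fubini'[symmetric]) measurable
    also have "\<dots> \<le> (\<integral>\<^sup>+w. ennreal (4 / pi * C0 * (cmod (f w) * omega w powr s * \<epsilon> n w)) \<partial>lborel)"
      by (intro nn_integral_mono inner)
    also have "\<dots> = ennreal (4 / pi * C0 * I n)"
      unfolding I_def integral_mult_right_zero[symmetric] using C0(1) eps(1)
      by (intro nn_integral_eq_integral integrable_mult_right Iint) simp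
    finally show ?thesis
      using dA[of n] C0(1) I0 by (intro A1I_nn_integral(2)) (auto simp: A1_iff)
  qed
  have "(\<lambda>n. L (F n)) \<longlonglongrightarrow> L f"
  proof (rule Lim_null[THEN iffD2], rule Lim_null_comparison)
    have "cmod (L (F n) - L f) \<le> N * (4 / pi * C0 * I n)" for n
    proof -
      have "L (d n) = L f - L (F n)"
        unfolding d_def by (subst A1_dual_linear[OF L f FA]) simp
      then have "cmod (L (F n) - L f) = cmod (L (d n))" by (simp add: norm_minus_commute)
      also have "\<dots> \<le> N * A1_norm s (d n)" unfolding N_def by (rule norm_le_A1_dual_norm[OF L dA])
      also have "\<dots> \<le> N * (4 / pi * C0 * I n)" by (rule mult_left_mono[OF norm_d N])
      finally show ?thesis .
    qed
    then show "\<forall>\<^sub>F n in sequentially. cmod (L (F n) - L f) \<le> N * (4 / pi * C0 * I n)" by simp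
    show "(\<lambda>n. N * (4 / pi * C0 * I n)) \<longlonglongrightarrow> 0"
      using tendsto_mult_left[OF lim2, of "N * (4 / pi * C0)"] by (simp add: mult_ac)
  qed
  moreover have "(\<lambda>n. L (F n)) \<longlonglongrightarrow> \<kappa> * (LBINT w. q w * L (cubic_kernel w))"
    unfolding LF by (rule tendsto_mult_left[OF lim1])
  ultimately have "L f = \<kappa> * (LBINT w. q w * L (cubic_kernel w))"
    by (rule LIMSEQ_unique)
  then show ?thesis by (simp add: q_def \<kappa>_def)
qed

subsection \<open>The duality\<close>

lemma pairing_linear:
  assumes "f \<in> A1 (- k)" "h \<in> A1 (- k)" "g \<in> bloch k"
  shows "pairing (\<lambda>z. a * f z + b * h z) g = a * pairing f g + b * pairing h g"
proof -
  have fh: "f \<in> holo_uhp" "h \<in> holo_uhp" using assms by (auto simp: A1_iff)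
  note int = pairing_integrable[OF assms(1,3)] pairing_integrable[OF assms(2,3)]
  have "pairing (\<lambda>z. a * f z + b * h z) g
      = (LBINT z. a * (f z * cnj (deriv g z) * Im z) + b * (h z * cnj (deriv g z) * Im z))"
    unfolding pairing_eq_integral[OF holo_uhp_lincomb[OF fh]] by (simp add: algebra_simps)
  also have "\<dots> = a * pairing f g + b * pairing h g"
    using int unfolding pairing_eq_integral[OF fh(1)] pairing_eq_integral[OF fh(2)]
    by (subst Bochner_Integration.integral_add) (auto simp only: integrable_mult_right integral_mult_right_zero)
  finally show ?thesis .
qed

lemma pairing_functional_in_dual:
  assumes g: "g \<in> bloch k"
  shows "pairing_functional k g \<in> A1_dual (- k)"
proof -
  have "\<exists>C. \<forall>f\<in>A1 (- k). cmod (pairing_functional k g f) \<le> C * A1_norm (- k) f"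
    using norm_pairing_le[OF _ g] by (auto simp: pairing_functional_def)
  then show ?thesis
    using pairing_linear[OF _ _ g] A1_lincomb by (simp add: A1_dual_def pairing_functional_def)
qed

lemma pairing_functional_respects: "pairing_functional k respects mod_const k"
proof (rule congruentI)
  fix g h assume gh: "(g, h) \<in> mod_const k"
  have "pairing f g = pairing f h" if "f \<in> A1 (- k)" for f
  proof -
    have fh: "f \<in> holo_uhp" using that by (simp add: A1_iff)
    have "f z * cnj (deriv g z) * Im z = f z * cnj (deriv h z) * Im z" for z
      using mod_const_deriv[OF gh, of z] holo_uhp_outside[OF fh, of z] by (cases "0 < Im z") (auto simp: uhp_iff)
    then show ?thesis by (simp only: pairing_eq_integral[OF fh])
  qed
  then show "pairing_functional k g = pairing_functional k h"
    by (auto simp: pairing_functional_def)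
qed

lemma induced_pairing_class:
  assumes g: "g \<in> bloch k"
  shows "induced_pairing k (bloch_class k g) = pairing_functional k g"
proof -
  have "pairing_functional k h = pairing_functional k g" if "h \<in> bloch_class k g" for h
    using that congruentD[OF pairing_functional_respects, of g h k] by (simp add: bloch_class_def)
  moreover have "g \<in> bloch_class k g"
    using equiv_class_self[OF equiv_mod_const g] by (simp add: bloch_class_def)
  ultimately have "pairing_functional k ` bloch_class k g = {pairing_functional k g}"
    by (intro equalityI subsetI) (blast, metis image_eqI singletonD)
  then show ?thesis by (simp add: induced_pairing_def)
qed

lemma bloch_quotE:
  assumes "X \<in> bloch_quot k"
  obtains g where "g \<in> bloch k" "X = bloch_class k g"
  using assms by (auto simp: bloch_quot_def bloch_class_def elim: quotientE)

lemma bloch_class_in_quot: "g \<in> bloch k \<Longrightarrow> bloch_class k g \<in> bloch_quot k"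
  by (simp add: bloch_quot_def bloch_class_def quotientI)

text \<open>The half plane is convex, so a function with vanishing derivative on it is constant;
  thus a class in the quotient is determined by its derivative.\<close>

lemma deriv_eq_imp_mod_const:
  assumes g: "g \<in> bloch k" and h: "h \<in> bloch k"
    and eq: "\<And>z. 0 < Im z \<Longrightarrow> deriv g z = deriv h z"
  shows "(g, h) \<in> mod_const k"
proof -
  have hol: "g holomorphic_on upper_half_plane" "h holomorphic_on upper_half_plane"
    using g h by (auto simp: bloch_def holo_uhp_def)
  have "\<exists>c. \<forall>z\<in>upper_half_plane. g z - h z = c"
  proof (rule has_field_derivative_zero_constant)
    show "convex upper_half_plane"
      unfolding upper_half_plane_def by (rule convex_halfspace_Im_gt)
    fix z assume z: "z \<in> upper_half_plane"
    have "((\<lambda>z. g z - h z) has_field_derivative deriv g z - deriv h z) (at z)"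
      by (intro DERIV_diff holomorphic_derivI[OF hol(1) open_upper_half_plane z]
          holomorphic_derivI[OF hol(2) open_upper_half_plane z])
    then show "((\<lambda>z. g z - h z) has_field_derivative 0) (at z within upper_half_plane)"
      using eq[of z] z by (simp add: uhp_iff has_field_derivative_at_within)
  qed
  then show ?thesis using g h by (force simp: mod_const_def algebra_simps)
qed

text \<open>The bound on the kernel norm makes the powers of \<open>omega w\<close> and the factor
  \<open>Im w\<close> cancel. One constant serves all L and g linked by the kernel identity, so the
  estimate shows both that a g constructed from L is a Bloch function and that the inverse map is
  bounded.\<close>

lemma deriv_le_A1_dual_norm:
  "\<exists>C. \<forall>L\<in>A1_dual (- k). \<forall>g w. 0 < Im w \<longrightarrow> cnj (deriv g w) = - (4 * \<i> / pi) * L (cubic_kernel w)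
      \<longrightarrow> Im w * omega w powr k * cmod (deriv g w) \<le> C * A1_dual_norm (- k) L"
proof -
  obtain C0 where C0: "0 < C0" "\<And>w. 0 < Im w \<Longrightarrow> cubic_kernel w \<in> A1 (- k)"
    "\<And>w. 0 < Im w \<Longrightarrow> A1_norm (- k) (cubic_kernel w) \<le> C0 * omega w powr (- k) / Im w"
    using cubic_kernel_A1_norm_le by blast
  have "Im w * omega w powr k * cmod (deriv g w) \<le> 4 / pi * C0 * A1_dual_norm (- k) L"
    if L: "L \<in> A1_dual (- k)" and eq: "cnj (deriv g w) = - (4 * \<i> / pi) * L (cubic_kernel w)" and w: "0 < Im w"
    for g L w
  proof -
    have o: "0 < omega w" using omega_ge_1[of w] by linarith
    have "cmod (deriv g w) = cmod (- (4 * \<i> / pi) * L (cubic_kernel w))"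
      using eq by (metis complex_mod_cnj)
    also have "\<dots> = 4 / pi * cmod (L (cubic_kernel w))" by (simp add: norm_mult norm_divide)
    also have "\<dots> \<le> 4 / pi * (A1_dual_norm (- k) L * A1_norm (- k) (cubic_kernel w))"
      by (intro mult_left_mono norm_le_A1_dual_norm[OF L C0(2)[OF w]]) simp
    also have "\<dots> \<le> 4 / pi * (A1_dual_norm (- k) L * (C0 * omega w powr (- k) / Im w))"
      by (intro mult_left_mono C0(3)[OF w] A1_dual_norm_nonneg[OF L]) simp
    finally have "Im w * omega w powr k * cmod (deriv g w)
        \<le> Im w * omega w powr k * (4 / pi * (A1_dual_norm (- k) L * (C0 * omega w powr (- k) / Im w)))"
      using w by (intro mult_left_mono) auto
    also have "\<dots> = 4 / pi * C0 * A1_dual_norm (- k) L * (omega w powr k * omega w powr (- k))"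
      using w by simp
    also have "omega w powr k * omega w powr (- k) = 1" using o by (simp flip: powr_add)
    finally show ?thesis by simp
  qed
  then show ?thesis by blast
qed

lemma A1_dual_eq_pairing_functional:
  assumes L: "L \<in> A1_dual (- k)"
  obtains g where "g \<in> bloch k" "pairing_functional k g = L"
proof -
  define G where "G w = cnj (- (4 * \<i> / pi) * L (cubic_kernel w))" for w
  have "(\<lambda>w. cnj (- (4 * \<i> / pi)) * cnj (L (cubic_kernel w))) holomorphic_on upper_half_plane"
    by (intro holomorphic_intros A1_dual_kernel_holomorphic[OF L])
  then have G: "G holomorphic_on upper_half_plane"
    unfolding G_def[abs_def] complex_cnj_mult .
  have "convex upper_half_plane"
    unfolding upper_half_plane_def by (rule convex_halfspace_Im_gt)
  then obtain g0 where g0: "\<And>z. z \<in> upper_half_plane \<Longrightarrow> (g0 has_field_derivative G z) (at z within upper_half_plane)"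
    using holomorphic_convex_primitive'[OF _ open_upper_half_plane G] by blast
  \<comment> \<open>The primitive is set to 0 off the half plane to represent an element of
    \<open>holo_uhp\<close>; derivatives inside the open half plane are unaffected.\<close>
  define g where "g z = (if z \<in> upper_half_plane then g0 z else 0)" for z
  have dg: "(g has_field_derivative G z) (at z)" if z: "z \<in> upper_half_plane" for z
  proof (rule has_field_derivative_transform_within_open[OF _ open_upper_half_plane z])
    show "(g0 has_field_derivative G z) (at z)"
      using g0[OF z] at_within_open[OF z open_upper_half_plane] by simp
  qed (simp add: g_def)
  have dg': "deriv g w = G w" if "0 < Im w" for w
    using dg[of w] that by (intro DERIV_imp_deriv) (simp add: uhp_iff)
  have eq: "cnj (deriv g w) = - (4 * \<i> / pi) * L (cubic_kernel w)" if "0 < Im w" for w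
    unfolding dg'[OF that] G_def by simp
  obtain C where C: "\<forall>L\<in>A1_dual (- k). \<forall>g w. 0 < Im w \<longrightarrow> cnj (deriv g w) = - (4 * \<i> / pi) * L (cubic_kernel w)
      \<longrightarrow> Im w * omega w powr k * cmod (deriv g w) \<le> C * A1_dual_norm (- k) L"
    using deriv_le_A1_dual_norm[of k] ..
  have "g holomorphic_on upper_half_plane"
    using dg open_upper_half_plane by (auto simp: holomorphic_on_open)
  then have "g \<in> holo_uhp" by (simp add: holo_uhp_def g_def)
  moreover have "bdd_above ((\<lambda>z. Im z * omega z powr k * cmod (deriv g z)) ` upper_half_plane)"
    using C L eq by (intro bdd_aboveI2[where M = "C * A1_dual_norm (- k) L"]) (simp add: uhp_iff)
  ultimately have g: "g \<in> bloch k" by (simp add: bloch_def)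
  have "pairing f g = L f" if f: "f \<in> A1 (- k)" for f
  proof -
    have fh: "f \<in> holo_uhp" using f by (simp add: A1_iff)
    \<comment> \<open>Inserting the equation that defines g' turns the pairing integral into the
      integral representation of L f.\<close>
    have "f w * cnj (deriv g w) * Im w = - (4 * \<i> / pi) * (f w * Im w * L (cubic_kernel w))" for w
      using eq[of w] holo_uhp_outside[OF fh, of w] by (cases "0 < Im w") auto
    then have "pairing f g = - (4 * \<i> / pi) * (LBINT w. f w * Im w * L (cubic_kernel w))"
      unfolding pairing_eq_integral[OF fh] by (simp only: integral_mult_right_zero)
    then show ?thesis using A1_dual_representation[OF f L] by simp
  qed
  moreover have "L f = 0" if "f \<notin> A1 (- k)" for f
    using L that by (simp add: A1_dual_def)
  ultimately have "pairing_functional k g = L"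
    by (auto simp: pairing_functional_def)
  with g show thesis by (rule that)
qed

lemma cnj_deriv_eq_pairing_functional:
  assumes "g \<in> bloch k" "0 < Im w"
  shows "cnj (deriv g w) = - (4 * \<i> / pi) * pairing_functional k g (cubic_kernel w)"
proof -
  have "cubic_kernel w \<in> A1 (- k)" using cubic_kernel_A1_norm_le[of "- k"] assms(2) by blast
  then show ?thesis using pairing_cubic_kernel[OF assms] by (simp add: pairing_functional_def)
qed

lemma induced_pairing_bij: "bij_betw (induced_pairing k) (bloch_quot k) (A1_dual (- k))"
  unfolding bij_betw_def
proof
  show "inj_on (induced_pairing k) (bloch_quot k)"
  proof (rule inj_onI)
    fix X Y assume XY: "X \<in> bloch_quot k" "Y \<in> bloch_quot k" "induced_pairing k X = induced_pairing k Y"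
    obtain g h where g: "g \<in> bloch k" "X = bloch_class k g" and h: "h \<in> bloch k" "Y = bloch_class k h"
      using XY(1,2) by (metis bloch_quotE)
    have eq: "pairing_functional k g = pairing_functional k h"
      using XY(3) g h by (simp add: induced_pairing_class)
    \<comment> \<open>Equal functionals agree on the kernels, and their values there are the
      conjugated derivatives up to a common constant.\<close>
    have "deriv g w = deriv h w" if "0 < Im w" for w
      using cnj_deriv_eq_pairing_functional[OF g(1) that] cnj_deriv_eq_pairing_functional[OF h(1) that]
      unfolding eq by (metis complex_cnj_cnj)
    then have "(g, h) \<in> mod_const k" by (rule deriv_eq_imp_mod_const[OF g(1) h(1)])
    then show "X = Y"
      unfolding g(2) h(2) bloch_class_def by (rule equiv_class_eq[OF equiv_mod_const])
  qed
  show "induced_pairing k ` bloch_quot k = A1_dual (- k)"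
  proof (intro equalityI subsetI)
    fix L assume "L \<in> induced_pairing k ` bloch_quot k"
    then show "L \<in> A1_dual (- k)"
      by (metis bloch_quotE imageE induced_pairing_class pairing_functional_in_dual)
  next
    fix L assume "L \<in> A1_dual (- k)"
    then obtain g where "g \<in> bloch k" "pairing_functional k g = L"
      by (rule A1_dual_eq_pairing_functional)
    then show "L \<in> induced_pairing k ` bloch_quot k"
      by (metis bloch_class_in_quot imageI induced_pairing_class)
  qed
qed

lemma pairing_functional_conj_linear:
  assumes g: "g \<in> bloch k" and h: "h \<in> bloch k"
  shows "pairing_functional k (\<lambda>z. a * g z + b * h z)
    = (\<lambda>f. cnj a * pairing_functional k g f + cnj b * pairing_functional k h f)"
proof -
  have hol: "g holomorphic_on upper_half_plane" "h holomorphic_on upper_half_plane"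
    using g h by (auto simp: bloch_def holo_uhp_def)
  have "pairing f (\<lambda>z. a * g z + b * h z) = cnj a * pairing f g + cnj b * pairing f h" if f: "f \<in> A1 (- k)" for f
  proof -
    have fh: "f \<in> holo_uhp" using f by (simp add: A1_iff)
    note int = pairing_integrable[OF f g] pairing_integrable[OF f h]
    have "f z * cnj (deriv (\<lambda>z. a * g z + b * h z) z) * Im z
        = cnj a * (f z * cnj (deriv g z) * Im z) + cnj b * (f z * cnj (deriv h z) * Im z)" for z
    proof (cases "0 < Im z")
      case True
      then have z: "z \<in> upper_half_plane" by (simp add: uhp_iff)
      have "deriv (\<lambda>z. a * g z + b * h z) z = a * deriv g z + b * deriv h z"
        by (intro DERIV_imp_deriv DERIV_add DERIV_cmult
            holomorphic_derivI[OF hol(1) open_upper_half_plane z] holomorphic_derivI[OF hol(2) open_upper_half_plane z])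
      then show ?thesis by (simp add: algebra_simps)
    qed (simp add: holo_uhp_outside[OF fh])
    then have "pairing f (\<lambda>z. a * g z + b * h z)
        = (LBINT z. cnj a * (f z * cnj (deriv g z) * Im z) + cnj b * (f z * cnj (deriv h z) * Im z))"
      by (simp only: pairing_eq_integral[OF fh])
    also have "\<dots> = cnj a * pairing f g + cnj b * pairing f h"
      using int unfolding pairing_eq_integral[OF fh]
      by (subst Bochner_Integration.integral_add) (auto simp only: integrable_mult_right integral_mult_right_zero)
    finally show ?thesis .
  qed
  then show ?thesis by (auto simp: pairing_functional_def)
qed

theorem theorem4:
  fixes k :: real
  shows
    "(\<forall>f\<in>A1 (- k). \<forall>g\<in>bloch k.
        set_integrable lborel upper_half_plane
          (\<lambda>z. f z * cnj (deriv g z) * complex_of_real (Im z))) \<and>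
     pairing_functional k respects mod_const k \<and>
     bij_betw (induced_pairing k) (bloch_quot k) (A1_dual (- k)) \<and>
     (\<forall>g\<in>bloch k. \<forall>h\<in>bloch k. \<forall>a b.
        induced_pairing k (bloch_class k (\<lambda>z. a * g z + b * h z)) =
          (\<lambda>f. cnj a * induced_pairing k (bloch_class k g) f
              + cnj b * induced_pairing k (bloch_class k h) f)) \<and>
     (\<exists>C. \<forall>X\<in>bloch_quot k.
        A1_dual_norm (- k) (induced_pairing k X) \<le> C * bloch_quot_norm k X) \<and>
     (\<exists>C. \<forall>L\<in>A1_dual (- k).
        bloch_quot_norm k (inv_into (bloch_quot k) (induced_pairing k) L)
          \<le> C * A1_dual_norm (- k) L)"
proof (intro conjI ballI allI)
  fix f g assume "f \<in> A1 (- k)" "g \<in> bloch k"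
  then show "set_integrable lborel upper_half_plane (\<lambda>z. f z * cnj (deriv g z) * complex_of_real (Im z))"
    using pairing_integrable[of f k g] by (simp add: A1_iff set_integrable_def pairing_integrand_eq)
next
  show "pairing_functional k respects mod_const k" by (rule pairing_functional_respects)
next
  show "bij_betw (induced_pairing k) (bloch_quot k) (A1_dual (- k))" by (rule induced_pairing_bij)
next
  fix g h a b assume "g \<in> bloch k" "h \<in> bloch k"
  then show "induced_pairing k (bloch_class k (\<lambda>z. a * g z + b * h z)) =
      (\<lambda>f. cnj a * induced_pairing k (bloch_class k g) f + cnj b * induced_pairing k (bloch_class k h) f)"
    by (simp add: induced_pairing_class bloch_lincomb pairing_functional_conj_linear)
next
  \<comment> \<open>The pairing is a contraction, as the pointwise estimate by the Bloch seminorm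
    loses no constant.\<close>
  have "A1_dual_norm (- k) (induced_pairing k X) \<le> 1 * bloch_quot_norm k X" if X: "X \<in> bloch_quot k" for X
  proof -
    obtain g where g: "g \<in> bloch k" "X = bloch_class k g" using X by (rule bloch_quotE)
    have "A1_dual_norm (- k) (pairing_functional k g) \<le> bloch_seminorm k g"
      using norm_pairing_le[OF _ g(1)] bloch_seminorm_nonneg[OF g(1)]
      by (intro A1_dual_norm_least) (auto simp: pairing_functional_def)
    then show ?thesis using g by (simp add: induced_pairing_class bloch_quot_norm_class)
  qed
  then show "\<exists>C. \<forall>X\<in>bloch_quot k. A1_dual_norm (- k) (induced_pairing k X) \<le> C * bloch_quot_norm k X"
    by blast
next
  obtain C where C: "\<forall>L\<in>A1_dual (- k). \<forall>g w. 0 < Im w \<longrightarrow> cnj (deriv g w) = - (4 * \<i> / pi) * L (cubic_kernel w)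
      \<longrightarrow> Im w * omega w powr k * cmod (deriv g w) \<le> C * A1_dual_norm (- k) L"
    using deriv_le_A1_dual_norm[of k] ..
  have "bloch_quot_norm k (inv_into (bloch_quot k) (induced_pairing k) L) \<le> C * A1_dual_norm (- k) L"
    if L: "L \<in> A1_dual (- k)" for L
  proof -
    define X where "X = inv_into (bloch_quot k) (induced_pairing k) L"
    have LX: "L \<in> induced_pairing k ` bloch_quot k"
      using induced_pairing_bij[of k] L by (simp add: bij_betw_def)
    then have X: "X \<in> bloch_quot k" "induced_pairing k X = L"
      unfolding X_def by (auto intro: inv_into_into f_inv_into_f)
    obtain g where g: "g \<in> bloch k" "X = bloch_class k g" using X(1) by (rule bloch_quotE)
    have gL: "pairing_functional k g = L" using X(2) g by (simp add: induced_pairing_class)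
    \<comment> \<open>A representative g of the preimage satisfies the kernel identity with L, which
      is the hypothesis of the uniform derivative bound.\<close>
    have "bloch_seminorm k g \<le> C * A1_dual_norm (- k) L"
      using cnj_deriv_eq_pairing_functional[OF g(1)] C L unfolding gL
      by (intro bloch_seminorm_least) blast
    then show ?thesis using g by (simp add: X_def[symmetric] bloch_quot_norm_class)
  qed
  then show "\<exists>C. \<forall>L\<in>A1_dual (- k).
      bloch_quot_norm k (inv_into (bloch_quot k) (induced_pairing k) L) \<le> C * A1_dual_norm (- k) L"
    by blast
qed

end
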